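(* Let $T>0$, $r>0$, $K>0$, $\sigma>0$, and let $$V(t,x)=\sup_{0\le\tau\le T-t}\mathsf E\big[e^{-r\tau}(K-X_\tau^x)^+\big],\qquad (t,x)\in[0,T]\times(0,\infty),$$ be the value function of the American put problem, where $X^x$ solves $dX_t=rX_t\,dt+\sigma X_t\,dB_t$ with $X_0=x$ and $B$ is a standard Brownian motion. Let $G(x)=(K-x)^+$, let $C=\{V>G\}$ be the continuation set, and let $\partial C$ be the optimal stopping boundary. Then the space derivative $V_x=\partial V/\partial x$ is continuous on $\partial C$: for every $z=(t,b(t))\in\partial C$ and every sequence $(t_n,x_n)\in C$ converging to $z$, $$\lim_{n\to\infty}V_x(t_n,x_n)=G_x(z)=-1.$$
   Context: The supremum is over stopping times $\tau$ of $X$ with $0\le\tau\le T-t$. The solution of the stochastic differential equation is $X_t^x=x\exp(\sigma B_t+(r-\sigma^2/2)t)$. The continuation set is $C=\{(t,x)\in[0,T]\times(0,\infty): V(t,x)>G(x)\}$, the stopping set is $D=\{(t,x)\in[0,T]\times(0,\infty): V(t,x)=G(x)\}$, and $\partial C$ is the boundary between $C$ and $D$. It is known that the optimal stopping time is $\tau_D^{t,x}=\inf\{s\in[0,T-t]: X_s^x\le b(t+s)\}$, where the optimal stopping boundary $t\mapsto b(t)$ is increasing on $[0,T]$ with $0<b(0)<b(T)=K$; points of $\partial C$ are written $z=(t,b(t))$. Here $G_x=\partial G/\partial x$; the gain function $G$ is not differentiable at $K$.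
   Formalization: The boundary point z=(t,b(t)) is taken with t<T: at t=T one has b(T)=K, where G is not differentiable, so G_x(z) is undefined and V_x has no limit there (e.g. it does not tend to -1 along (T-1/n,K)). *)

theory Defs
  imports "HOL-Probability.Probability"
begin

locale standard_brownian_motion = prob_space M for M :: "'a measure" +
  fixes B :: "real \<Rightarrow> 'a \<Rightarrow> real"
  assumes measurable_B: "\<And>t. 0 \<le> t \<Longrightarrow> random_variable borel (B t)"
    and start_zero: "\<And>\<omega>. \<omega> \<in> space M \<Longrightarrow> B 0 \<omega> = 0"
    and continuous_paths: "\<And>\<omega>. \<omega> \<in> space M \<Longrightarrow> continuous_on {0..} (\<lambda>t. B t \<omega>)"
    and normal_increments: "\<And>s t. 0 \<le> s \<Longrightarrow> s < t \<Longrightarrow>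
      distributed M lborel (\<lambda>\<omega>. B t \<omega> - B s \<omega>) (normal_density 0 (sqrt (t - s)))"
    and independent_increments: "\<And>(s :: nat \<Rightarrow> real) n. 0 \<le> s 0 \<Longrightarrow> (\<And>i. i < n \<Longrightarrow> s i < s (Suc i)) \<Longrightarrow>
      indep_vars (\<lambda>_. borel) (\<lambda>i \<omega>. B (s (Suc i)) \<omega> - B (s i) \<omega>) {..<n}"

text \<open>The strong solution, started at \<open>x\<close>, of \<open>dX = r X dt + \<sigma> X dB\<close>.\<close>

definition gbm :: "(real \<Rightarrow> 'a \<Rightarrow> real) \<Rightarrow> real \<Rightarrow> real \<Rightarrow> real \<Rightarrow> real \<Rightarrow> 'a \<Rightarrow> real" where
  "gbm B r \<sigma> x t \<omega> = x * exp (\<sigma> * B t \<omega> + (r - \<sigma>\<^sup>2 / 2) * t)"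

text \<open>Time is \<open>[0,\<infinity>)\<close>; at negative indices the \<sigma>-algebra is trivial.\<close>

definition natural_filtration :: "'a measure \<Rightarrow> (real \<Rightarrow> 'a \<Rightarrow> real) \<Rightarrow> real \<Rightarrow> 'a measure" where
  "natural_filtration M X t =
     sigma (space M) {X s -` A \<inter> space M | s A. 0 \<le> s \<and> s \<le> t \<and> A \<in> sets borel}"

definition stopping_times_upto :: "'a measure \<Rightarrow> (real \<Rightarrow> 'a \<Rightarrow> real) \<Rightarrow> real \<Rightarrow> ('a \<Rightarrow> real) set" where
  "stopping_times_upto M X u =
     {\<tau>. stopping_time (natural_filtration M X) \<tau> \<and> (\<forall>\<omega>\<in>space M. 0 \<le> \<tau> \<omega> \<and> \<tau> \<omega> \<le> u)}"

definition put_gain :: "real \<Rightarrow> real \<Rightarrow> real" where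
  "put_gain K x = max (K - x) 0"

definition put_value ::
  "'a measure \<Rightarrow> (real \<Rightarrow> 'a \<Rightarrow> real) \<Rightarrow> real \<Rightarrow> real \<Rightarrow> real \<Rightarrow> real \<Rightarrow> real \<Rightarrow> real \<Rightarrow> real" where
  "put_value M B r \<sigma> K T t x =
     (SUP \<tau>\<in>stopping_times_upto M (gbm B r \<sigma> x) (T - t).
        prob_space.expectation M (\<lambda>\<omega>. exp (- r * \<tau> \<omega>) * put_gain K (gbm B r \<sigma> x (\<tau> \<omega>) \<omega>)))"

definition state_space :: "real \<Rightarrow> (real \<times> real) set" where
  "state_space T = {0..T} \<times> {0<..}"

definition continuation_set ::
  "'a measure \<Rightarrow> (real \<Rightarrow> 'a \<Rightarrow> real) \<Rightarrow> real \<Rightarrow> real \<Rightarrow> real \<Rightarrow> real \<Rightarrow> (real \<times> real) set" where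
  "continuation_set M B r \<sigma> K T =
     {(t, x) \<in> state_space T. put_value M B r \<sigma> K T t x > put_gain K x}"

definition stopping_set ::
  "'a measure \<Rightarrow> (real \<Rightarrow> 'a \<Rightarrow> real) \<Rightarrow> real \<Rightarrow> real \<Rightarrow> real \<Rightarrow> real \<Rightarrow> (real \<times> real) set" where
  "stopping_set M B r \<sigma> K T =
     {(t, x) \<in> state_space T. put_value M B r \<sigma> K T t x = put_gain K x}"

text \<open>The boundary is taken relative to the state space: the frontier in the plane would also
  contain the part of the edge \<open>t = 0\<close> that lies in the continuation set.\<close>

definition continuation_boundary ::
  "'a measure \<Rightarrow> (real \<Rightarrow> 'a \<Rightarrow> real) \<Rightarrow> real \<Rightarrow> real \<Rightarrow> real \<Rightarrow> real \<Rightarrow> (real \<times> real) set" where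
  "continuation_boundary M B r \<sigma> K T =
     (top_of_set (state_space T)) frontier_of (continuation_set M B r \<sigma> K T)"

text \<open>For \<open>t < T\<close> the section of the stopping set at \<open>t\<close> is \<open>{0<..b t}\<close> with \<open>b t < K\<close>. The bound
  \<open>x \<le> K\<close> matters only at \<open>t = T\<close>, where the section is \<open>{0<..}\<close>: it yields \<open>b T = K\<close>.\<close>

definition stopping_boundary ::
  "'a measure \<Rightarrow> (real \<Rightarrow> 'a \<Rightarrow> real) \<Rightarrow> real \<Rightarrow> real \<Rightarrow> real \<Rightarrow> real \<Rightarrow> real \<Rightarrow> real" where
  "stopping_boundary M B r \<sigma> K T t =
     Sup {x. 0 < x \<and> x \<le> K \<and> (t, x) \<in> stopping_set M B r \<sigma> K T}"

end

theory Submission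
  imports Defs "HOL-Real_Asymp.Real_Asymp"
begin

text \<open>
  Restricting the exercise times to a grid turns the value function \<open>V(t, \<cdot>)\<close> into a limit of iterates
  of the Bellman operator \<open>f \<mapsto> max G (Q\<^sub>\<delta> f)\<close>, where \<open>Q\<^sub>\<delta> f x = E[exp(-r\<delta>) f(X\<^sub>\<delta>)]\<close>. Hence \<open>V(t, \<cdot>)\<close> is
  convex and 1-Lipschitz and \<open>V\<close> is a supermartingale along \<open>X\<close>. Extending the horizon from \<open>u'\<close> to \<open>u\<close>
  raises the iterates by at most the sensitivity of European put prices to the total volatility, so
  by at most \<open>x \<sigma> (\<surd>u - \<surd>u')\<close>. Together these give \<open>Q\<^sub>s V(t, \<cdot>) \<le> V(t, \<cdot>) + O(s)\<close> at fixed
  \<open>t < T\<close>. A convex kink at \<open>x\<close> would contribute \<open>E|X\<^sub>s - x|\<close>, of order \<open>\<surd>s\<close>, to the left side;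
  hence \<open>V(t, \<cdot>)\<close> is differentiable at every \<open>x > 0\<close>, the points of the stopping boundary included.
  There it agrees with \<open>G\<close> on the left, so its slope is \<open>-1\<close>. Convergence of the derivatives along
  the sequence follows from convexity, continuity of \<open>V\<close>, and the bound \<open>-1\<close> from below.
\<close>

subsection \<open>The standard Gaussian measure\<close>

text \<open>The kink comparison is a race between orders in s, and it shapes the estimates. A kink
  is worth order sqrt s because X_s - x fluctuates on that scale. Between the horizons u - s and u
  the bound x \<sigma> (sqrt u - sqrt (u - s)) is of order s only because the square root is smooth
  away from 0; between 0 and s it is of order sqrt s itself, consistent with V(T, .) = G having a
  kink at K. Volatility enters because one more period is worth no more than the discounted
  expectation of what it is worth when it is the last one: taking the maximum with G is
  nonexpansive. Moving the discount from the payoff into the price keeps the forward price fixed as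
  that last period is added, so that only the total volatility changes. The recursion also replaces
  the stopping times, whose filtration is defined anew for each x, by functions of the price;
  convexity, Lipschitz constants and bounds pass through each of its steps.\<close>

definition gauss :: "real measure" where
  "gauss = density lborel std_normal_density"

lemma sets_gauss [simp, measurable_cong]: "sets gauss = sets borel"
  and space_gauss [simp]: "space gauss = UNIV"
  by (simp_all add: gauss_def)

interpretation gauss: prob_space gauss
  unfolding gauss_def by (rule prob_space_normal_density) simp

text \<open>Cameron-Martin in one dimension: the weight is the density of N(a,1) relative to N(0,1),
  as completing the square shows.\<close>

lemma
  fixes g :: "real \<Rightarrow> real"
  assumes [measurable]: "g \<in> borel_measurable borel"
  shows integrable_gauss_shift:
      "integrable gauss (\<lambda>z. exp (a * z - a\<^sup>2 / 2) * g z) \<longleftrightarrow> integrable gauss (\<lambda>z. g (z + a))"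
    and integral_gauss_shift:
      "(\<integral>z. exp (a * z - a\<^sup>2 / 2) * g z \<partial>gauss) = (\<integral>z. g (z + a) \<partial>gauss)"
proof -
  define h where "h z = std_normal_density z * g (z + a)" for z
  \<comment> \<open>The form \<open>- a + 1 * z\<close> is the one that the affine substitution
    rules for \<open>lborel\<close> expect.\<close>
  have dens: "std_normal_density z * (exp (a * z - a\<^sup>2 / 2) * g z) = h (- a + 1 * z)" for z
  proof -
    have "exp (- z\<^sup>2 / 2) * exp (a * z - a\<^sup>2 / 2) = exp (- (- a + z)\<^sup>2 / 2)"
      unfolding exp_add[symmetric] by (rule arg_cong[of _ _ exp]) (simp add: power2_eq_square field_simps)
    then show ?thesis by (simp add: std_normal_density_def h_def)
  qed
  have "integrable gauss (\<lambda>z. exp (a * z - a\<^sup>2 / 2) * g z) \<longleftrightarrow> integrable lborel (\<lambda>z. h (- a + 1 * z))"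
    unfolding gauss_def by (subst integrable_density) (simp_all only: dens real_scaleR_def, simp_all)
  also have "\<dots> \<longleftrightarrow> integrable lborel h"
    by (subst lborel_integrable_real_affine_iff) auto
  also have "\<dots> \<longleftrightarrow> integrable gauss (\<lambda>z. g (z + a))"
    unfolding gauss_def by (subst integrable_density) (auto simp: h_def[abs_def])
  finally show "integrable gauss (\<lambda>z. exp (a * z - a\<^sup>2 / 2) * g z) \<longleftrightarrow> integrable gauss (\<lambda>z. g (z + a))" .
  have "(\<integral>z. exp (a * z - a\<^sup>2 / 2) * g z \<partial>gauss) = (\<integral>z. h (- a + 1 * z) \<partial>lborel)"
    unfolding gauss_def by (subst integral_density) (simp_all only: dens real_scaleR_def, simp_all)
  also have "\<dots> = (\<integral>z. h z \<partial>lborel)"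
    by (subst lborel_integral_real_affine[of 1 h "- a"]) simp_all
  also have "\<dots> = (\<integral>z. g (z + a) \<partial>gauss)"
    unfolding gauss_def by (subst integral_density) (auto simp: h_def[abs_def])
  finally show "(\<integral>z. exp (a * z - a\<^sup>2 / 2) * g z \<partial>gauss) = (\<integral>z. g (z + a) \<partial>gauss)" .
qed

lemma integrable_gauss_exp [simp]: "integrable gauss (\<lambda>z. exp (a * z - a\<^sup>2 / 2))"
  and integral_gauss_exp: "(\<integral>z. exp (a * z - a\<^sup>2 / 2) \<partial>gauss) = 1"
  using integrable_gauss_shift[of "\<lambda>_. 1" a] integral_gauss_shift[of "\<lambda>_. 1" a]
  by (simp_all add: gauss.prob_space[simplified])

lemma integrable_gauss_indicator: "A \<in> sets borel \<Longrightarrow> integrable gauss (indicator A :: real \<Rightarrow> real)"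
  by (rule integrable_real_indicator) (auto simp: gauss.emeasure_eq_measure)

text \<open>The density stays below 1. This linear bound is what makes put prices Lipschitz in the
  total volatility.\<close>

lemma gauss_interval_le:
  assumes "c \<le> d"
  shows "measure gauss {c..<d} \<le> d - c"
proof -
  have "std_normal_density x \<le> 1" for x
  proof -
    have "1 \<le> sqrt (2 * pi)" using pi_gt3 by simp
    moreover have "exp (- x\<^sup>2 / 2) \<le> 1" by simp
    ultimately have "exp (- x\<^sup>2 / 2) \<le> sqrt (2 * pi)" by linarith
    then show ?thesis by (simp add: std_normal_density_def)
  qed
  then have "emeasure gauss {c..<d} \<le> (\<integral>\<^sup>+ x. indicator {c..<d} x \<partial>lborel)"
    unfolding gauss_def
    by (subst emeasure_density, simp, simp, intro nn_integral_mono) (simp split: split_indicator)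
  also have "\<dots> = ennreal (d - c)"
    using assms by simp
  finally show ?thesis
    using assms by (simp add: gauss.emeasure_eq_measure)
qed

lemma gauss_interval_pos:
  assumes "c < d"
  shows "0 < measure gauss {c..d}"
proof (rule ccontr)
  assume "\<not> 0 < measure gauss {c..d}"
  then have "emeasure gauss {c..d} = 0"
    by (simp add: gauss.emeasure_eq_measure zero_less_measure_iff)
  then have "(\<integral>\<^sup>+ x. ennreal (std_normal_density x) * indicator {c..d} x \<partial>lborel) = 0"
    unfolding gauss_def by (subst (asm) emeasure_density) auto
  then have "AE x in lborel. ennreal (std_normal_density x) * indicator {c..d} x = 0"
    by (subst (asm) nn_integral_0_iff_AE) auto
  then have "AE x in lborel. x \<notin> {c..d}"
    by eventually_elim (auto simp: std_normal_density_def split: split_indicator_asm)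
  then have "emeasure lborel {c..d} = 0"
    by (subst (asm) AE_iff_null_sets[symmetric]) auto
  with assms show False by simp
qed

text \<open>Bounding the increment of the payoff by its subgradient on \<open>{Z < d}\<close>, the set where the put with
  volatility \<open>a'\<close> is exercised, and shifting the Gaussian leaves \<open>c\<close> times the probability of
  \<open>{d - a'..<d - a}\<close>.\<close>

lemma put_volatility_increment:
  fixes K c a a' :: real
  assumes "0 < c" "0 \<le> a" "a \<le> a'"
  shows "(\<integral>z. max (K - c * exp (a' * z - a'\<^sup>2 / 2)) 0 \<partial>gauss) -
      (\<integral>z. max (K - c * exp (a * z - a\<^sup>2 / 2)) 0 \<partial>gauss) \<le> c * (a' - a)"
\<comment> \<open>Separated because the threshold \<open>d\<close> below takes the logarithm of
  \<open>K / c\<close> and divides by \<open>a'\<close>. In this case both put prices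
  coincide.\<close>
proof (cases "a' = 0 \<or> K \<le> 0")
  case True
  then show ?thesis
  proof
    assume "a' = 0"
    with assms show ?thesis by simp
  next
    assume "K \<le> 0"
    then have "max (K - c * exp y) 0 = 0" for y
      using assms(1) by (simp add: max_def) (smt (verit) exp_gt_zero mult_pos_pos)
    with assms show ?thesis by simp
  qed
next
  case False
  then have "0 < a'" "0 < K" using assms by auto
  define X where "X a z = c * exp (a * z - a\<^sup>2 / 2)" for a z
  define d where "d = (ln (K / c) + a'\<^sup>2 / 2) / a'"
  have iff: "X a' z < K \<longleftrightarrow> z < d" for z
  proof -
    have "X a' z < K \<longleftrightarrow> exp (a' * z - a'\<^sup>2 / 2) < exp (ln (K / c))"
      using \<open>0 < c\<close> \<open>0 < K\<close> by (simp add: X_def field_simps)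
    also have "\<dots> \<longleftrightarrow> z < d"
      using \<open>0 < a'\<close> by (simp add: d_def field_simps)
    finally show ?thesis .
  qed
  have intX: "integrable gauss (X a)" for a
    by (simp add: X_def[abs_def])
  have [measurable]: "X a \<in> borel_measurable borel" for a
    by (simp add: X_def[abs_def])
  have intput: "integrable gauss (\<lambda>z. max (K - X a z) 0)" for a
    using intX by (intro integrable_max) auto
  have ind: "integrable gauss (\<lambda>z. indicator {..<d} z * X a z)" for a
    by (rule Bochner_Integration.integrable_bound[OF intX[of a]]) (auto split: split_indicator)
  have val: "(\<integral>z. indicator {..<d} z * X a z \<partial>gauss) = c * measure gauss {..<d - a}" for a
  proof -
    have "(\<integral>z. indicator {..<d} z * X a z \<partial>gauss) = c * (\<integral>z. exp (a * z - a\<^sup>2 / 2) * indicator {..<d} z \<partial>gauss)"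
      by (subst integral_mult_right_zero[symmetric]) (simp add: X_def ac_simps)
    also have "\<dots> = c * (\<integral>z. indicator {..<d} (z + a) \<partial>gauss)"
      by (subst integral_gauss_shift) auto
    also have "(\<lambda>z. indicator {..<d} (z + a)) = (indicator {..<d - a} :: real \<Rightarrow> real)"
      by (auto split: split_indicator)
    finally show ?thesis by simp
  qed
  have "(\<integral>z. max (K - X a' z) 0 \<partial>gauss) - (\<integral>z. max (K - X a z) 0 \<partial>gauss)
      = (\<integral>z. max (K - X a' z) 0 - max (K - X a z) 0 \<partial>gauss)"
    using intput by simp
  also have "\<dots> \<le> (\<integral>z. indicator {..<d} z * X a z - indicator {..<d} z * X a' z \<partial>gauss)"
    using intput ind by (intro integral_mono) (auto simp: iff[symmetric] split: split_indicator)
  also have "\<dots> = c * (measure gauss {..<d - a} - measure gauss {..<d - a'})"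
    using ind by (simp add: val right_diff_distrib)
  also have "measure gauss {..<d - a} - measure gauss {..<d - a'} = measure gauss {d - a'..<d - a}"
    using assms by (subst gauss.finite_measure_Diff[symmetric]) (auto intro!: arg_cong[of _ _ "measure gauss"])
  also have "c * \<dots> \<le> c * (a' - a)"
    using gauss_interval_le[of "d - a'" "d - a"] assms by simp
  finally show ?thesis by (simp add: X_def)
qed

subsection \<open>Kinks of convex functions\<close>

text \<open>Slopes through \<open>x\<close> are monotone, so the one-sided derivatives exist as a
  supremum \<open>L\<close> and an infimum \<open>R\<close>. Either they agree, or the maximum of
  the two one-sided tangents is a wedge below \<open>f\<close> that touches it at
  \<open>x\<close>.\<close>

lemma convex_differentiable_or_kink:
  fixes f :: "real \<Rightarrow> real"
  assumes f: "convex_on {0<..} f" and x: "0 < x"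
  obtains (differentiable) "f differentiable at x"
    | (kink) m c where "0 < c" "\<And>y. 0 < y \<Longrightarrow> f x + m * (y - x) + c * \<bar>y - x\<bar> \<le> f y"
proof -
  define S where "S y = (f y - f x) / (y - x)" for y
  have flip: "(f a - f b) / (a - b) = (f b - f a) / (b - a)" for a b
    by (metis minus_diff_eq minus_divide_divide)
  have S_mono: "S y \<le> S z" if yz: "0 < y" "y < z" "y \<noteq> x" "z \<noteq> x" for y z
  proof -
    consider "x < y" | "y < x \<and> x < z" | "z < x" using yz by linarith
    then show ?thesis
    proof cases
      case 1
      have "(f x - f y) / (x - y) \<le> (f x - f z) / (x - z)"
        by (rule convex_on_slope_le[OF f]) (use 1 that x in auto)
      then show ?thesis by (simp add: S_def flip[of x y] flip[of x z])
    next
      case 2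
      have "(f y - f x) / (y - x) \<le> (f y - f z) / (y - z)" "(f y - f z) / (y - z) \<le> (f x - f z) / (x - z)"
        by (rule convex_on_slope_le[OF f]; use 2 that x in auto)+
      then show ?thesis by (simp add: S_def flip[of x z])
    next
      case 3
      have "(f y - f x) / (y - x) \<le> (f z - f x) / (z - x)"
        by (rule convex_on_slope_le[OF f]) (use 3 that x in auto)
      then show ?thesis by (simp add: S_def)
    qed
  qed
  define R where "R = (INF y\<in>{x<..}. S y)"
  define L where "L = (SUP y\<in>{0<..<x}. S y)"
  \<comment> \<open>Any slope on one side of \<open>x\<close> bounds all slopes on the other;
    \<open>x/2\<close> and \<open>2 * x\<close> are arbitrary samples.\<close>
  have bdd: "bdd_below (S ` {x<..})" "bdd_above (S ` {0<..<x})"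
    using x S_mono[of "x/2"] S_mono[of _ "2 * x"]
    by (auto intro!: bdd_belowI2[of _ "S (x/2)"] bdd_aboveI2[of _ _ "S (2 * x)"])
  have R_le: "R \<le> S y" if "x < y" for y
    unfolding R_def by (rule cINF_lower[OF bdd(1)]) (use that in auto)
  have L_ge: "S y \<le> L" if "0 < y" "y < x" for y
    unfolding L_def by (rule cSUP_upper[OF _ bdd(2)]) (use that in auto)
  have "L \<le> R"
    unfolding L_def R_def using x
    by (intro cSUP_least cINF_greatest) (auto intro!: S_mono)
  show ?thesis
  proof (cases "L = R")
    case True
    have "(S \<longlongrightarrow> R) (at x)"
      unfolding tendsto_iff
    proof safe
      fix e :: real assume "0 < e"
      obtain y where y: "x < y" "S y < R + e"
        using cINF_less_iff[OF _ bdd(1), of "R + e"] \<open>0 < e\<close> unfolding R_def[symmetric] by auto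
      obtain w where w: "0 < w" "w < x" "L - e < S w"
        using less_cSUP_iff[OF _ bdd(2), of "L - e"] \<open>0 < e\<close> x unfolding L_def[symmetric]
        by auto
      have "eventually (\<lambda>v. v \<in> {w<..<y} - {x}) (at x)"
        using y w by (intro eventually_at_in_open) auto
      then show "\<forall>\<^sub>F v in at x. dist (S v) R < e"
      proof eventually_elim
        case (elim v)
        then have "S v \<le> S y" "S w \<le> S v" using w y x by (auto intro!: S_mono)
        with True y w show ?case by (auto simp: dist_real_def abs_if)
      qed
    qed
    then have "(f has_real_derivative R) (at x)"
      by (simp add: has_field_derivative_iff S_def[abs_def])
    then show thesis
      using differentiable real_differentiable_def by blast
  next
    case False
    \<comment> \<open>Mean slope and half the jump: on each side of \<open>x\<close> the wedge
      coincides with the tangent of slope \<open>L\<close> or \<open>R\<close>.\<close>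
    have "f x + (L + R) / 2 * (y - x) + (R - L) / 2 * \<bar>y - x\<bar> \<le> f y" if "0 < y" for y
    proof (cases y x rule: linorder_cases)
      case less
      then have "L * (y - x) \<le> S y * (y - x)"
        using L_ge[OF that less] by (intro mult_right_mono_neg) auto
      moreover have "(L + R) / 2 * (y - x) + (R - L) / 2 * \<bar>y - x\<bar> = L * (y - x)"
        using less by (simp add: field_simps)
      ultimately show ?thesis using less by (simp add: S_def)
    next
      case greater
      then have "R * (y - x) \<le> S y * (y - x)"
        using R_le[of y] by (intro mult_right_mono) auto
      moreover have "(L + R) / 2 * (y - x) + (R - L) / 2 * \<bar>y - x\<bar> = R * (y - x)"
        using greater by (simp add: field_simps)
      ultimately show ?thesis using greater by (simp add: S_def)
    qed simp
    then show thesis using False \<open>L \<le> R\<close> by (intro kink[of "(R - L) / 2" "(L + R) / 2"]) auto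
  qed
qed

subsection \<open>The Markov property\<close>

lemma space_natural_filtration [simp]: "space (natural_filtration M X t) = space M"
  unfolding natural_filtration_def by (rule space_measure_of) auto

lemma sets_natural_filtration:
  "sets (natural_filtration M X t) =
    sigma_sets (space M) {X s -` A \<inter> space M | s A. 0 \<le> s \<and> s \<le> t \<and> A \<in> sets borel}"
  unfolding natural_filtration_def by (rule sets_measure_of) auto

lemma measurable_natural_filtration:
  "0 \<le> s \<Longrightarrow> s \<le> t \<Longrightarrow> X s \<in> borel_measurable (natural_filtration M X t)"
  unfolding measurable_def space_natural_filtration sets_natural_filtration
  by (auto intro!: sigma_sets.Basic)

lemma sets_natural_filtration_mono:
  "s \<le> t \<Longrightarrow> sets (natural_filtration M X s) \<subseteq> sets (natural_filtration M X t)"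
  unfolding sets_natural_filtration by (rule sigma_sets_mono') (auto intro: order_trans)

context standard_brownian_motion
begin

lemma sets_natural_filtration_subset: "sets (natural_filtration M B t) \<subseteq> sets M"
  unfolding sets_natural_filtration
  by (rule sets.sigma_sets_subset) (auto intro!: measurable_sets[OF measurable_B])

text \<open>Writing the increment as sqrt d times a standard Gaussian includes d = 0, which
  \<open>normal_increments\<close> does not cover and where the law has no density.\<close>

lemma distr_increment:
  assumes "0 \<le> s" "0 \<le> d"
  shows "distr M borel (\<lambda>\<omega>. B (s + d) \<omega> - B s \<omega>) = distr gauss borel (\<lambda>z. sqrt d * z)"
proof (cases "d = 0")
  case True
  then show ?thesis
    using prob_space_axioms gauss.prob_space_axioms by (simp add: distr_const)
next
  case False
  with assms have "0 < d" by simp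
  have [measurable]: "random_variable borel (\<lambda>\<omega>. B (s + d) \<omega> - B s \<omega>)"
    using assms by (intro borel_measurable_diff measurable_B) auto
  have "distributed M lborel (\<lambda>\<omega>. (B (s + d) \<omega> - B s \<omega> - 0) / sqrt d) std_normal_density"
    using normal_increments[of s "s + d"] assms \<open>0 < d\<close>
    by (subst normal_standard_normal_convert[symmetric]) auto
  then have "distr M lborel (\<lambda>\<omega>. (B (s + d) \<omega> - B s \<omega>) / sqrt d) = gauss"
    by (simp add: distributed_def gauss_def)
  then have "distr gauss borel (\<lambda>z. sqrt d * z) =
      distr (distr M lborel (\<lambda>\<omega>. (B (s + d) \<omega> - B s \<omega>) / sqrt d)) borel (\<lambda>z. sqrt d * z)"
    by simp
  also have "\<dots> = distr M borel (\<lambda>\<omega>. B (s + d) \<omega> - B s \<omega>)"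
    using \<open>0 < d\<close> by (subst distr_distr) (auto simp: comp_def)
  finally show ?thesis by simp
qed

lemma distr_B: "0 \<le> t \<Longrightarrow> distr M borel (B t) = distr gauss borel (\<lambda>z. sqrt t * z)"
  using distr_increment[of 0 t] start_zero by (simp cong: distr_cong)

lemma
  fixes g :: "real \<Rightarrow> real"
  assumes "0 \<le> t" and [measurable]: "g \<in> borel_measurable borel"
  shows integrable_B_iff: "integrable M (\<lambda>\<omega>. g (B t \<omega>)) \<longleftrightarrow> integrable gauss (\<lambda>z. g (sqrt t * z))"
    and expectation_B: "expectation (\<lambda>\<omega>. g (B t \<omega>)) = (\<integral>z. g (sqrt t * z) \<partial>gauss)"
proof -
  have [measurable]: "random_variable borel (B t)" using assms measurable_B by simp
  show "integrable M (\<lambda>\<omega>. g (B t \<omega>)) \<longleftrightarrow> integrable gauss (\<lambda>z. g (sqrt t * z))"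
    using arg_cong[OF distr_B[OF assms(1)], of "\<lambda>N. integrable N g"]
    by (simp add: integrable_distr_eq)
  show "expectation (\<lambda>\<omega>. g (B t \<omega>)) = (\<integral>z. g (sqrt t * z) \<partial>gauss)"
    using arg_cong[OF distr_B[OF assms(1)], of "\<lambda>N. integral\<^sup>L N g"]
    by (simp add: integral_distr)
qed

text \<open>The axioms give independence only for consecutive increments along a finite increasing
  grid. A past cylinder event is therefore rewritten through the increments up to \<open>s\<close>,
  the values of \<open>B\<close> being their partial sums.\<close>

lemma prob_past_increment:
  assumes "0 \<le> s" "0 < d" and J: "finite J" "J \<subseteq> {0..s}"
    and A: "\<And>q. A q \<in> sets borel" and C: "C \<in> sets borel"
  shows "prob ({\<omega> \<in> space M. \<forall>q\<in>J. B q \<omega> \<in> A q} \<inter> ((\<lambda>\<omega>. B (s + d) \<omega> - B s \<omega>) -` C \<inter> space M)) =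
    prob {\<omega> \<in> space M. \<forall>q\<in>J. B q \<omega> \<in> A q} * prob ((\<lambda>\<omega>. B (s + d) \<omega> - B s \<omega>) -` C \<inter> space M)"
proof -
  \<comment> \<open>With 0 in the grid every value is a sum of increments, since \<open>B\<close>
    starts at 0; with \<open>s\<close> in it the next increment starts exactly at
    \<open>s\<close>.\<close>
  define S where "S = insert 0 (insert s J)"
  have S: "finite S" "S \<subseteq> {0..s}" "0 \<in> S" "s \<in> S" using assms by (auto simp: S_def)
  define L where "L = sorted_list_of_set S"
  have L: "set L = S" "sorted_wrt (<) L" using S by (auto simp: L_def)
  define n where "n = length L - 1"
  have len: "length L = Suc n" using S L by (cases L) (auto simp: n_def)
  have L_less: "L ! i < L ! j" if "i < j" "j \<le> n" for i j
    using L(2) that by (auto simp: sorted_wrt_iff_nth_less len)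
  have L0: "L ! 0 = 0"
  proof -
    obtain i where i: "i \<le> n" "L ! i = 0" using S(3) L(1) len by (metis in_set_conv_nth less_Suc_eq_le)
    have "L ! 0 \<in> S" using L(1) len by (metis nth_mem zero_less_Suc)
    then show ?thesis using i L_less[of 0 i] S(2) by (cases "i = 0") (auto simp: subset_eq)
  qed
  have Ln: "L ! n = s"
  proof -
    obtain i where i: "i \<le> n" "L ! i = s" using S(4) L(1) len by (metis in_set_conv_nth less_Suc_eq_le)
    have "L ! n \<in> S" using L(1) len by (metis nth_mem lessI)
    then show ?thesis using i L_less[of i n] S(2) by (cases "i = n") (auto simp: subset_eq)
  qed
  \<comment> \<open>The sorted points from \<open>L ! 0 = 0\<close> to \<open>L ! n = s\<close> are
    followed by \<open>s + d\<close>: increments with index below \<open>n\<close> belong to the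
    past, increment \<open>n\<close> is the future one.\<close>
  define t where "t i = (if i \<le> n then L ! i else s + d)" for i
  define inc where "inc i \<omega> = B (t (Suc i)) \<omega> - B (t i) \<omega>" for i \<omega>
  have ind: "indep_vars (\<lambda>_. borel) inc {..<Suc n}"
    unfolding inc_def
  proof (rule independent_increments)
    show "0 \<le> t 0" by (simp add: t_def L0)
    show "t i < t (Suc i)" if "i < Suc n" for i
      using that L_less[of i "Suc i"] Ln assms by (cases "i = n") (auto simp: t_def)
  qed
  have incn: "inc n \<omega> = B (s + d) \<omega> - B s \<omega>" for \<omega>
    by (simp add: inc_def t_def Ln)
  have sum_inc: "(\<Sum>i<k. inc i \<omega>) = B (L ! k) \<omega>" if "k \<le> n" "\<omega> \<in> space M" for k \<omega>
    using that start_zero unfolding inc_def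
    by (subst sum_lessThan_telescope) (simp add: t_def L0)
  define I where "I = {k. k \<le> n \<and> L ! k \<in> J}"
  have "finite I" by (simp add: I_def)
  have J_eq: "J = (\<lambda>k. L ! k) ` I"
  proof -
    have "J \<subseteq> set L" using L(1) by (auto simp: S_def)
    then show ?thesis by (auto simp: I_def in_set_conv_nth len less_Suc_eq_le subset_eq image_iff)
  qed
  have indv: "indep_var (PiM {..<n} (\<lambda>_. borel)) (\<lambda>\<omega>. restrict (\<lambda>i. inc i \<omega>) {..<n})
     (PiM {n} (\<lambda>_. borel)) (\<lambda>\<omega>. restrict (\<lambda>i. inc i \<omega>) {n})"
    by (rule indep_var_restrict[OF ind]) auto
  define U where "U = {v \<in> space (PiM {..<n} (\<lambda>_. borel :: real measure)). \<forall>k\<in>I. (\<Sum>i<k. v i) \<in> A (L ! k)}"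
  define W where "W = {v \<in> space (PiM {n} (\<lambda>_. borel :: real measure)). v n \<in> C}"
  have U: "U \<in> sets (PiM {..<n} (\<lambda>_. borel))"
    unfolding U_def
  proof (rule sets.sets_Collect_finite_All)
    fix k assume "k \<in> I"
    then have "(\<lambda>v. \<Sum>i<k. v i) \<in> borel_measurable (PiM {..<n} (\<lambda>_. borel :: real measure))"
      by (intro borel_measurable_sum measurable_component_singleton) (auto simp: I_def)
    from measurable_sets[OF this A[of "L ! k"]]
    show "{v \<in> space (PiM {..<n} (\<lambda>_. borel)). (\<Sum>i<k. v i) \<in> A (L ! k)} \<in> sets (PiM {..<n} (\<lambda>_. borel :: real measure))"
      by (simp add: vimage_def Int_def conj_commute)
  qed (use \<open>finite I\<close> in auto)
  have W: "W \<in> sets (PiM {n} (\<lambda>_. borel))"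
    unfolding W_def using C by measurable
  have eqU: "(\<lambda>\<omega>. restrict (\<lambda>i. inc i \<omega>) {..<n}) -` U \<inter> space M = {\<omega> \<in> space M. \<forall>q\<in>J. B q \<omega> \<in> A q}"
  proof -
    have "(\<Sum>i<k. restrict (\<lambda>i. inc i \<omega>) {..<n} i) = B (L ! k) \<omega>" if "k \<in> I" "\<omega> \<in> space M" for k \<omega>
    proof -
      have "(\<Sum>i<k. restrict (\<lambda>i. inc i \<omega>) {..<n} i) = (\<Sum>i<k. inc i \<omega>)"
        using that by (intro sum.cong) (auto simp: I_def)
      with sum_inc[of k \<omega>] that show ?thesis by (auto simp: I_def)
    qed
    then show ?thesis
      unfolding U_def J_eq by (auto simp: space_PiM)
  qed
  have eqW: "(\<lambda>\<omega>. restrict (\<lambda>i. inc i \<omega>) {n}) -` W \<inter> space M = (\<lambda>\<omega>. B (s + d) \<omega> - B s \<omega>) -` C \<inter> space M"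
    by (auto simp: W_def space_PiM incn)
  have "(\<lambda>\<omega>. (restrict (\<lambda>i. inc i \<omega>) {..<n}, restrict (\<lambda>i. inc i \<omega>) {n})) -` (U \<times> W) \<inter> space M =
    ((\<lambda>\<omega>. restrict (\<lambda>i. inc i \<omega>) {..<n}) -` U \<inter> space M) \<inter> ((\<lambda>\<omega>. restrict (\<lambda>i. inc i \<omega>) {n}) -` W \<inter> space M)"
    by auto
  then show ?thesis
    using indep_varD[OF indv U W] unfolding eqU eqW by simp
qed

text \<open>Cylinder events are an intersection-stable generator of the past, so independence
  extends from them to the whole sigma-algebra.\<close>

lemma indep_past_increment:
  assumes "0 \<le> s" "0 < d"
    and F: "F \<in> sets (natural_filtration M B s)" and C: "C \<in> sets borel"
  shows "prob (F \<inter> ((\<lambda>\<omega>. B (s + d) \<omega> - B s \<omega>) -` C \<inter> space M)) =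
    prob F * prob ((\<lambda>\<omega>. B (s + d) \<omega> - B s \<omega>) -` C \<inter> space M)"
proof -
  define D where "D \<omega> = B (s + d) \<omega> - B s \<omega>" for \<omega>
  have D [measurable]: "random_variable borel D"
    using assms unfolding D_def by (auto intro!: borel_measurable_diff measurable_B)
  define Cyl where "Cyl = {{\<omega> \<in> space M. \<forall>q\<in>J. B q \<omega> \<in> A q} | J A.
    finite J \<and> J \<subseteq> {0..s} \<and> (\<forall>q. A q \<in> sets borel)}"
  define DD where "DD = {D -` C \<inter> space M | C. C \<in> sets borel}"
  have ev: "Cyl \<subseteq> events"
  proof (clarsimp simp: Cyl_def)
    fix J and A :: "real \<Rightarrow> real set"
    assume "finite J" "J \<subseteq> {0..s}" and A: "\<forall>q. A q \<in> sets borel"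
    show "{\<omega> \<in> space M. \<forall>q\<in>J. B q \<omega> \<in> A q} \<in> events"
    proof (rule sets.sets_Collect_finite_All)
      fix q assume "q \<in> J"
      then have "random_variable borel (B q)" using \<open>J \<subseteq> {0..s}\<close> by (auto intro!: measurable_B)
      from measurable_sets[OF this, of "A q"] A show "{\<omega> \<in> space M. B q \<omega> \<in> A q} \<in> events"
        by (simp add: vimage_def Int_def conj_commute)
    qed fact
  qed
  have "indep_set Cyl DD"
    unfolding indep_sets2_eq
  proof (intro conjI ballI)
    show "Cyl \<subseteq> events" by fact
    show "DD \<subseteq> events" by (auto simp: DD_def)
    fix a b assume "a \<in> Cyl" "b \<in> DD"
    then show "prob (a \<inter> b) = prob a * prob b"
      using prob_past_increment[OF assms(1,2)] by (auto simp: Cyl_def DD_def D_def[abs_def])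
  qed
  moreover have "Int_stable Cyl"
  proof (rule Int_stableI)
    fix a b assume "a \<in> Cyl" "b \<in> Cyl"
    then obtain J A J' A' where a: "a = {\<omega> \<in> space M. \<forall>q\<in>J. B q \<omega> \<in> A q}" "finite J" "J \<subseteq> {0..s}" "\<forall>q. A q \<in> sets borel"
      and b: "b = {\<omega> \<in> space M. \<forall>q\<in>J'. B q \<omega> \<in> A' q}" "finite J'" "J' \<subseteq> {0..s}" "\<forall>q. A' q \<in> sets borel"
      unfolding Cyl_def by blast
    \<comment> \<open>A time constrained by only one of the two cylinders gets the trivial condition
      \<open>UNIV\<close> from the other.\<close>
    let ?A = "\<lambda>q. (if q \<in> J then A q else UNIV) \<inter> (if q \<in> J' then A' q else UNIV)"
    have "a \<inter> b = {\<omega> \<in> space M. \<forall>q\<in>J \<union> J'. B q \<omega> \<in> ?A q}"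
      by (auto simp: a b)
    moreover have "finite (J \<union> J')" "J \<union> J' \<subseteq> {0..s}" "\<forall>q. ?A q \<in> sets borel"
      using a b by auto
    ultimately show "a \<inter> b \<in> Cyl"
      unfolding Cyl_def by (intro CollectI exI[of _ "J \<union> J'"] exI[of _ ?A] conjI)
  qed
  moreover have "Int_stable DD"
  proof (rule Int_stableI)
    fix a b assume "a \<in> DD" "b \<in> DD"
    then obtain C C' where "a = D -` C \<inter> space M" "b = D -` C' \<inter> space M" "C \<in> sets borel" "C' \<in> sets borel"
      unfolding DD_def by blast
    then have "a \<inter> b = D -` (C \<inter> C') \<inter> space M" "C \<inter> C' \<in> sets borel" by auto
    then show "a \<inter> b \<in> DD" unfolding DD_def by (intro CollectI exI[of _ "C \<inter> C'"] conjI)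
  qed
  ultimately have ind: "indep_set (sigma_sets (space M) Cyl) (sigma_sets (space M) DD)"
    by (rule indep_set_sigma_sets)
  have sub: "sets (natural_filtration M B s) \<subseteq> sigma_sets (space M) Cyl"
    unfolding sets_natural_filtration
  proof (rule sigma_sets_mono')
    show "{B q -` A \<inter> space M | q A. 0 \<le> q \<and> q \<le> s \<and> A \<in> sets borel} \<subseteq> Cyl"
    proof clarsimp
      fix q and A :: "real set" assume "0 \<le> q" "q \<le> s" "A \<in> sets borel"
      then show "B q -` A \<inter> space M \<in> Cyl"
        unfolding Cyl_def by (intro CollectI exI[of _ "{q}"] exI[of _ "\<lambda>_. A"]) auto
    qed
  qed
  have "D -` C \<inter> space M \<in> sigma_sets (space M) DD"
    using C by (auto simp: DD_def intro!: sigma_sets.Basic)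
  with indep_setD[OF ind _ this] sub F show ?thesis by (auto simp: D_def[abs_def])
qed

text \<open>Independence as a product law. The sample point, seen only through the past
  sigma-algebra, stands for the whole history, which makes Fubini available for any integrand that
  depends on the past.\<close>

lemma distr_past_increment:
  assumes "0 \<le> s" "0 < d"
  shows "distr M (natural_filtration M B s \<Otimes>\<^sub>M borel) (\<lambda>\<omega>. (\<omega>, B (s + d) \<omega> - B s \<omega>)) =
    distr M (natural_filtration M B s) (\<lambda>\<omega>. \<omega>) \<Otimes>\<^sub>M distr M borel (\<lambda>\<omega>. B (s + d) \<omega> - B s \<omega>)"
proof -
  define D where "D \<omega> = B (s + d) \<omega> - B s \<omega>" for \<omega>
  have D [measurable]: "random_variable borel D"
    using assms unfolding D_def by (auto intro!: borel_measurable_diff measurable_B)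
  have I [measurable]: "(\<lambda>\<omega>. \<omega>) \<in> M \<rightarrow>\<^sub>M natural_filtration M B s"
    using sets_natural_filtration_subset[of s] by (auto simp: measurable_def)
  have "distr M (natural_filtration M B s) (\<lambda>\<omega>. \<omega>) \<Otimes>\<^sub>M distr M borel D =
    distr M (natural_filtration M B s \<Otimes>\<^sub>M borel) (\<lambda>\<omega>. (\<omega>, D \<omega>))"
  proof (rule pair_measure_eqI)
    show "sigma_finite_measure (distr M (natural_filtration M B s) (\<lambda>\<omega>. \<omega>))"
      "sigma_finite_measure (distr M borel D)"
      by (intro prob_space_imp_sigma_finite prob_space_distr I D)+
    fix F C assume "F \<in> sets (distr M (natural_filtration M B s) (\<lambda>\<omega>. \<omega>))" "C \<in> sets (distr M borel D)"
    then have F [measurable]: "F \<in> sets (natural_filtration M B s)" and C [measurable]: "C \<in> sets borel" by auto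
    have FM: "F \<in> events" using F sets_natural_filtration_subset by blast
    have "emeasure (distr M (natural_filtration M B s \<Otimes>\<^sub>M borel) (\<lambda>\<omega>. (\<omega>, D \<omega>))) (F \<times> C) = prob (F \<inter> (D -` C \<inter> space M))"
      by (subst emeasure_distr) (auto simp: emeasure_eq_measure intro!: arg_cong[of _ _ prob])
    also have "\<dots> = prob F * prob (D -` C \<inter> space M)"
      using indep_past_increment[OF assms F C] by (simp add: D_def[abs_def])
    also have "\<dots> = emeasure (distr M (natural_filtration M B s) (\<lambda>\<omega>. \<omega>)) F * emeasure (distr M borel D) C"
      using FM sets.sets_into_space[OF FM]
      by (simp add: emeasure_distr emeasure_eq_measure ennreal_mult vimage_def Int_absorb2 Collect_mem_eq)
    finally show "emeasure (distr M (natural_filtration M B s) (\<lambda>\<omega>. \<omega>)) F * emeasure (distr M borel D) C =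
      emeasure (distr M (natural_filtration M B s \<Otimes>\<^sub>M borel) (\<lambda>\<omega>. (\<omega>, D \<omega>))) (F \<times> C)" by simp
  qed simp
  then show ?thesis by (simp add: D_def[abs_def])
qed

text \<open>Freezing: the past is held fixed while the independent increment is averaged
  out.\<close>

lemma expectation_past_increment:
  fixes h :: "'a \<Rightarrow> real \<Rightarrow> real"
  assumes s: "0 \<le> s" "0 \<le> d"
    and h: "case_prod h \<in> borel_measurable (natural_filtration M B s \<Otimes>\<^sub>M borel)"
    and int: "integrable M (\<lambda>\<omega>. h \<omega> (B (s + d) \<omega> - B s \<omega>))"
  shows "expectation (\<lambda>\<omega>. h \<omega> (B (s + d) \<omega> - B s \<omega>)) = expectation (\<lambda>\<omega>. \<integral>z. h \<omega> (sqrt d * z) \<partial>gauss)"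
proof (cases "d = 0")
  case True
  then show ?thesis by (simp add: gauss.prob_space[simplified])
next
  case False
  then have "0 < d" using s by simp
  note prod = distr_past_increment[OF s(1) \<open>0 < d\<close>]
  define D where "D \<omega> = B (s + d) \<omega> - B s \<omega>" for \<omega>
  have D [measurable]: "random_variable borel D"
    using s unfolding D_def by (auto intro!: borel_measurable_diff measurable_B)
  have I [measurable]: "(\<lambda>\<omega>. \<omega>) \<in> M \<rightarrow>\<^sub>M natural_filtration M B s"
    using sets_natural_filtration_subset[of s] by (auto simp: measurable_def)
  note h [measurable]
  let ?N = "distr M (natural_filtration M B s) (\<lambda>\<omega>. \<omega>)" and ?G = "distr M borel D"
  interpret N: prob_space ?N by (rule prob_space_distr) fact
  interpret G: prob_space ?G by (rule prob_space_distr) fact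
  interpret pair_sigma_finite ?N ?G ..
  have prod: "?N \<Otimes>\<^sub>M ?G = distr M (natural_filtration M B s \<Otimes>\<^sub>M borel) (\<lambda>\<omega>. (\<omega>, D \<omega>))"
    using prod by (simp add: D_def[abs_def])
  have intp: "integrable (?N \<Otimes>\<^sub>M ?G) (case_prod h)"
    unfolding prod using int by (subst integrable_distr_eq) (simp_all add: D_def[symmetric])
  have "expectation (\<lambda>\<omega>. h \<omega> (D \<omega>)) = integral\<^sup>L (?N \<Otimes>\<^sub>M ?G) (case_prod h)"
    unfolding prod by (subst integral_distr) simp_all
  also have "\<dots> = (\<integral>\<omega>. (\<integral>z. h \<omega> z \<partial>?G) \<partial>?N)"
    using integral_fst'[OF intp] by simp
  also have "\<dots> = (\<integral>\<omega>. (\<integral>z. h \<omega> z \<partial>?G) \<partial>M)"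
  proof (subst integral_distr)
    have "(\<lambda>\<omega>. \<integral>z. h \<omega> z \<partial>?G) \<in> borel_measurable ?N"
      by (rule G.borel_measurable_lebesgue_integral) (simp add: h)
    then show "(\<lambda>\<omega>. \<integral>z. h \<omega> z \<partial>?G) \<in> borel_measurable (natural_filtration M B s)" by simp
  qed simp_all
  also have "\<dots> = expectation (\<lambda>\<omega>. \<integral>z. h \<omega> (sqrt d * z) \<partial>gauss)"
  proof (rule Bochner_Integration.integral_cong)
    fix \<omega> assume "\<omega> \<in> space M"
    then have "h \<omega> \<in> borel_measurable borel"
      using h by (auto dest: measurable_Pair2 simp: space_natural_filtration)
    then show "(\<integral>z. h \<omega> z \<partial>?G) = (\<integral>z. h \<omega> (sqrt d * z) \<partial>gauss)"
      unfolding D_def distr_increment[OF s] by (subst integral_distr) simp_all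
  qed simp
  finally show ?thesis by (simp add: D_def)
qed

end

subsection \<open>The Black--Scholes kernel\<close>

lemma lipschitz_abs_le:
  fixes f :: "real \<Rightarrow> real"
  assumes "L-lipschitz_on UNIV f"
  shows "\<bar>f x - f y\<bar> \<le> L * \<bar>x - y\<bar>"
  using lipschitz_onD[OF assms, of x y] by (simp add: dist_real_def)

lemma lipschitz_borel_measurable:
  fixes f :: "real \<Rightarrow> real"
  assumes "L-lipschitz_on UNIV f"
  shows "f \<in> borel_measurable borel"
  by (intro borel_measurable_continuous_onI lipschitz_on_continuous_on[OF assms])

lemma lipschitz_max:
  fixes f g :: "real \<Rightarrow> real"
  assumes "L-lipschitz_on UNIV f" "L-lipschitz_on UNIV g"
  shows "L-lipschitz_on UNIV (\<lambda>x. max (f x) (g x))"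
proof (rule lipschitz_onI)
  fix x y :: real
  show "dist (max (f x) (g x)) (max (f y) (g y)) \<le> L * dist x y"
    using lipschitz_abs_le[OF assms(1), of x y] lipschitz_abs_le[OF assms(2), of x y]
    by (simp add: dist_real_def)
qed (rule lipschitz_on_nonneg[OF assms(1)])

lemma convex_on_max:
  fixes f g :: "real \<Rightarrow> real"
  assumes "convex_on S f" "convex_on S g"
  shows "convex_on S (\<lambda>x. max (f x) (g x))"
proof
  fix t x y :: real
  assume t: "0 < t" "t < 1" and S: "x \<in> S" "y \<in> S"
  have "(1 - t) * f x \<le> (1 - t) * max (f x) (g x)" "t * f y \<le> t * max (f y) (g y)"
    "(1 - t) * g x \<le> (1 - t) * max (f x) (g x)" "t * g y \<le> t * max (f y) (g y)"
    using t by (auto intro!: mult_left_mono)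
  with convex_onD[OF assms(1), of t x y] convex_onD[OF assms(2), of t x y] t S
  show "max (f ((1 - t) *\<^sub>R x + t *\<^sub>R y)) (g ((1 - t) *\<^sub>R x + t *\<^sub>R y))
    \<le> (1 - t) * max (f x) (g x) + t * max (f y) (g y)" by linarith
qed (rule convex_on_imp_convex[OF assms(1)])

text \<open>Lipschitz functions grow at most linearly. Below, a Lipschitz bound on all of the real
  line therefore serves as the one hypothesis that yields both measurability and
  integrability.\<close>

lemma integrable_lipschitz:
  fixes f :: "real \<Rightarrow> real"
  assumes N: "finite_measure N" and f: "L-lipschitz_on UNIV f" and g: "integrable N g"
  shows "integrable N (\<lambda>x. f (g x))"
proof (rule Bochner_Integration.integrable_bound)
  show "integrable N (\<lambda>x. \<bar>f 0\<bar> + L * \<bar>g x\<bar>)"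
    by (intro Bochner_Integration.integrable_add integrable_mult_right integrable_abs g finite_measure.integrable_const[OF N])
  show "(\<lambda>x. f (g x)) \<in> borel_measurable N"
    using lipschitz_borel_measurable[OF f] g by simp
  show "AE x in N. norm (f (g x)) \<le> norm (\<bar>f 0\<bar> + L * \<bar>g x\<bar>)"
  proof (rule AE_I2)
    fix x
    have "0 \<le> L * \<bar>g x\<bar>" using lipschitz_on_nonneg[OF f] by simp
    then show "norm (f (g x)) \<le> norm (\<bar>f 0\<bar> + L * \<bar>g x\<bar>)"
      using lipschitz_abs_le[OF f, of "g x" 0] by simp
  qed
qed

locale black_scholes = standard_brownian_motion M B
  for M :: "'a measure" and B :: "real \<Rightarrow> 'a \<Rightarrow> real" +
  fixes r \<sigma> K :: real
  assumes r_pos: "0 < r" and \<sigma>_pos: "0 < \<sigma>" and K_pos: "0 < K"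
begin

abbreviation "X \<equiv> gbm B r \<sigma>"

abbreviation "G \<equiv> put_gain K"

text \<open>The ratio of X_d to its starting value, with \<open>sqrt d * z\<close> in place of the
  Brownian motion at time d.\<close>

definition growth :: "real \<Rightarrow> real \<Rightarrow> real" where
  "growth d z = exp (\<sigma> * (sqrt d * z) + (r - \<sigma>\<^sup>2 / 2) * d)"

text \<open>The transition operator of the price, kept apart from its discounted version
  \<open>Q\<close> because \<open>berm_step_le\<close> moves the discount from the payoff into the
  price.\<close>

definition P :: "real \<Rightarrow> (real \<Rightarrow> real) \<Rightarrow> real \<Rightarrow> real" where
  "P d f x = (\<integral>z. f (x * growth d z) \<partial>gauss)"

definition Q :: "real \<Rightarrow> (real \<Rightarrow> real) \<Rightarrow> real \<Rightarrow> real" where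
  "Q d f x = exp (- r * d) * P d f x"

lemma growth_pos: "0 < growth d z"
  by (simp add: growth_def)

text \<open>The last factor is a Gaussian exponential of mean one and total volatility
  \<open>\<sigma> * sqrt d\<close>, the form used in the Gaussian section.\<close>

lemma growth_eq:
  assumes "0 \<le> d"
  shows "growth d z = exp (r * d) * exp ((\<sigma> * sqrt d) * z - (\<sigma> * sqrt d)\<^sup>2 / 2)"
  unfolding growth_def exp_add[symmetric] using assms
  by (intro arg_cong[of _ _ exp]) (simp add: power_mult_distrib field_simps)

lemma borel_measurable_growth [measurable]: "growth d \<in> borel_measurable borel"
  unfolding growth_def[abs_def] by measurable

lemma
  assumes "0 \<le> d"
  shows integrable_growth: "integrable gauss (growth d)"
    and integral_growth: "(\<integral>z. growth d z \<partial>gauss) = exp (r * d)"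
proof -
  have "growth d = (\<lambda>z. exp (r * d) * exp ((\<sigma> * sqrt d) * z - (\<sigma> * sqrt d)\<^sup>2 / 2))"
    using assms growth_eq by auto
  then show "integrable gauss (growth d)" "(\<integral>z. growth d z \<partial>gauss) = exp (r * d)"
    using integrable_gauss_exp[of "\<sigma> * sqrt d"] integral_gauss_exp[of "\<sigma> * sqrt d"]
    by simp_all
qed

lemma growth_0 [simp]: "growth 0 z = 1"
  by (simp add: growth_def)

lemma gbm_add: "X x (s + d) \<omega> = X x s \<omega> * exp (\<sigma> * (B (s + d) \<omega> - B s \<omega>) + (r - \<sigma>\<^sup>2 / 2) * d)"
  by (simp add: gbm_def mult.assoc exp_add[symmetric]) (simp add: algebra_simps)

lemma gbm_pos: "0 < x \<Longrightarrow> 0 < X x t \<omega>"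
  by (simp add: gbm_def)

lemma borel_measurable_gbm: "0 \<le> t \<Longrightarrow> random_variable borel (X x t)"
  unfolding gbm_def[abs_def] using measurable_B by measurable

lemma integrable_gbm: "0 \<le> t \<Longrightarrow> integrable M (X x t)"
  using integrable_B_iff[of t "\<lambda>b. x * exp (\<sigma> * b + (r - \<sigma>\<^sup>2 / 2) * t)"] integrable_growth[of t]
  by (simp add: gbm_def[abs_def] growth_def[abs_def])

lemma integrable_lipschitz_gbm:
  fixes f :: "real \<Rightarrow> real"
  shows "L-lipschitz_on UNIV f \<Longrightarrow> 0 \<le> t \<Longrightarrow> integrable M (\<lambda>\<omega>. f (X x t \<omega>))"
  by (rule integrable_lipschitz[OF finite_measure_axioms _ integrable_gbm])

lemma integrable_lipschitz_growth:
  fixes f :: "real \<Rightarrow> real"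
  shows "L-lipschitz_on UNIV f \<Longrightarrow> 0 \<le> d \<Longrightarrow> integrable gauss (\<lambda>z. f (x * growth d z))"
  by (rule integrable_lipschitz[OF gauss.finite_measure_axioms]) (simp_all add: integrable_growth)

lemma P_eq_expectation:
  assumes "L-lipschitz_on UNIV f" "0 \<le> t"
  shows "P t f x = expectation (\<lambda>\<omega>. f (X x t \<omega>))"
proof -
  have [measurable]: "f \<in> borel_measurable borel" by (rule lipschitz_borel_measurable) fact
  show ?thesis
    using expectation_B[OF assms(2), of "\<lambda>b. f (x * exp (\<sigma> * b + (r - \<sigma>\<^sup>2 / 2) * t))"]
    by (simp add: P_def growth_def gbm_def[abs_def])
qed

lemma P_lipschitz:
  assumes f: "L-lipschitz_on UNIV f" and d: "0 \<le> d"
  shows "(exp (r * d) * L)-lipschitz_on UNIV (P d f)"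
proof (rule lipschitz_onI)
  fix x y :: real
  note int = integrable_lipschitz_growth[OF f d]
  have "dist (P d f x) (P d f y) = \<bar>\<integral>z. f (x * growth d z) - f (y * growth d z) \<partial>gauss\<bar>"
    using int by (simp add: P_def dist_real_def)
  also have "\<dots> \<le> (\<integral>z. \<bar>f (x * growth d z) - f (y * growth d z)\<bar> \<partial>gauss)"
    by (rule integral_abs_bound)
  also have "\<dots> \<le> (\<integral>z. L * \<bar>x - y\<bar> * growth d z \<partial>gauss)"
  proof (rule integral_mono)
    fix z
    show "\<bar>f (x * growth d z) - f (y * growth d z)\<bar> \<le> L * \<bar>x - y\<bar> * growth d z"
      using lipschitz_abs_le[OF f, of "x * growth d z" "y * growth d z"] growth_pos[of d z]
      by (simp add: left_diff_distrib[symmetric] abs_mult mult.assoc)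
  qed (use int integrable_growth[OF d] in auto)
  also have "\<dots> = exp (r * d) * L * dist x y"
    using integral_growth[OF d] by (simp add: dist_real_def)
  finally show "dist (P d f x) (P d f y) \<le> exp (r * d) * L * dist x y" .
qed (use lipschitz_on_nonneg[OF f] in auto)

text \<open>Discounting cancels exactly the factor \<open>exp (r * d)\<close> that \<open>P\<close>
  puts on the Lipschitz constant, so the constant survives any number of Bellman steps.\<close>

lemma Q_lipschitz:
  assumes f: "L-lipschitz_on UNIV f" and d: "0 \<le> d"
  shows "L-lipschitz_on UNIV (Q d f)"
proof (rule lipschitz_onI)
  fix x y :: real
  have "dist (Q d f x) (Q d f y) = exp (- r * d) * dist (P d f x) (P d f y)"
    by (simp add: Q_def dist_real_def right_diff_distrib[symmetric] abs_mult)
  also have "\<dots> \<le> exp (- r * d) * (exp (r * d) * L * dist x y)"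
    by (intro mult_left_mono lipschitz_onD[OF P_lipschitz[OF f d]]) auto
  finally show "dist (Q d f x) (Q d f y) \<le> L * dist x y"
    by (simp add: mult.assoc[symmetric] exp_add[symmetric])
qed (rule lipschitz_on_nonneg[OF f])

lemma Q_convex:
  assumes f: "L-lipschitz_on UNIV f" "convex_on UNIV f" and d: "0 \<le> d"
  shows "convex_on UNIV (Q d f)"
proof
  fix t x y :: real
  assume t: "0 < t" "t < 1"
  note int = integrable_lipschitz_growth[OF f(1) d]
  have "P d f ((1 - t) * x + t * y) \<le> (\<integral>z. (1 - t) * f (x * growth d z) + t * f (y * growth d z) \<partial>gauss)"
    unfolding P_def
  proof (rule integral_mono)
    fix z
    show "f (((1 - t) * x + t * y) * growth d z) \<le> (1 - t) * f (x * growth d z) + t * f (y * growth d z)"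
      using convex_onD[OF f(2), of t "x * growth d z" "y * growth d z"] t
      by (simp add: algebra_simps)
  qed (use int in auto)
  also have "\<dots> = (1 - t) * P d f x + t * P d f y"
    using int by (simp add: P_def)
  finally have "exp (- r * d) * P d f ((1 - t) * x + t * y) \<le> exp (- r * d) * ((1 - t) * P d f x + t * P d f y)"
    by (intro mult_left_mono) auto
  then show "Q d f ((1 - t) *\<^sub>R x + t *\<^sub>R y) \<le> (1 - t) * Q d f x + t * Q d f y"
    by (simp add: Q_def algebra_simps)
qed auto

text \<open>Domination is asked for at positive prices only: bounds such as \<open>berm_le\<close>
  fail at negative ones, where \<open>G\<close> exceeds \<open>K\<close>.\<close>

lemma P_mono:
  assumes "L-lipschitz_on UNIV f" "L'-lipschitz_on UNIV g" "0 \<le> d"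
    and "\<And>y. 0 < y \<Longrightarrow> f y \<le> g y" and "0 < x"
  shows "P d f x \<le> P d g x"
  unfolding P_def using assms growth_pos
  by (intro integral_mono integrable_lipschitz_growth) auto

lemma Q_mono:
  assumes "L-lipschitz_on UNIV f" "L'-lipschitz_on UNIV g" "0 \<le> d"
    and "\<And>y. 0 < y \<Longrightarrow> f y \<le> g y" and "0 < x"
  shows "Q d f x \<le> Q d g x"
  unfolding Q_def by (intro mult_left_mono P_mono[OF assms]) auto

lemma P_diff:
  assumes "L-lipschitz_on UNIV f" "L'-lipschitz_on UNIV g" "0 \<le> d"
  shows "P d (\<lambda>x. f x - g x) x = P d f x - P d g x"
  using integrable_lipschitz_growth[OF assms(1,3)] integrable_lipschitz_growth[OF assms(2,3)]
  by (simp add: P_def)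

lemma Q_diff:
  assumes "L-lipschitz_on UNIV f" "L'-lipschitz_on UNIV g" "0 \<le> d"
  shows "Q d (\<lambda>x. f x - g x) x = Q d f x - Q d g x"
  using P_diff[OF assms] by (simp add: Q_def right_diff_distrib)

section \<open>Markov property and semigroup law of the price\<close>

lemma borel_measurable_gbm_natural_filtration:
  "0 \<le> s \<Longrightarrow> s \<le> t \<Longrightarrow> X x s \<in> borel_measurable (natural_filtration M B t)"
  unfolding gbm_def[abs_def] using measurable_natural_filtration[of s t B M] by measurable

text \<open>Conditioning on the past is expressed by integrating over an arbitrary past event
  \<open>A\<close>; the increment factor in \<open>gbm_add\<close> is averaged out by
  \<open>expectation_past_increment\<close>.\<close>

lemma markov:
  assumes f: "L-lipschitz_on UNIV f" and s: "0 \<le> s" and d: "0 \<le> d"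
    and A: "A \<in> sets (natural_filtration M B s)"
  shows "expectation (\<lambda>\<omega>. indicator A \<omega> * f (X x (s + d) \<omega>)) =
    expectation (\<lambda>\<omega>. indicator A \<omega> * P d f (X x s \<omega>))"
proof -
  define h where "h \<omega> z = indicator A \<omega> * f (X x s \<omega> * exp (\<sigma> * z + (r - \<sigma>\<^sup>2 / 2) * d))" for \<omega> z
  have [measurable]: "f \<in> borel_measurable borel" by (rule lipschitz_borel_measurable) fact
  have [measurable]: "X x s \<in> borel_measurable (natural_filtration M B s)"
    using borel_measurable_gbm_natural_filtration[OF s] by simp
  note A [measurable]
  have "A \<in> events" using A sets_natural_filtration_subset by blast
  have "integrable M (\<lambda>\<omega>. indicator A \<omega> * f (X x (s + d) \<omega>))"
    using integrable_real_mult_indicator[OF \<open>A \<in> events\<close> integrable_lipschitz_gbm[OF f, of "s + d" x]] s d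
    by (simp add: mult.commute)
  then have "expectation (\<lambda>\<omega>. h \<omega> (B (s + d) \<omega> - B s \<omega>)) = expectation (\<lambda>\<omega>. \<integral>z. h \<omega> (sqrt d * z) \<partial>gauss)"
    by (intro expectation_past_increment s d) (simp_all add: h_def gbm_add[of _ s d], measurable)
  then show ?thesis
    by (simp add: h_def gbm_add[of _ s d] P_def growth_def)
qed

text \<open>Chapman-Kolmogorov, read off from \<open>markov\<close> with the whole space as past
  event instead of convolving Gaussians.\<close>

lemma P_P:
  assumes f: "L-lipschitz_on UNIV f" and s: "0 \<le> s" and d: "0 \<le> d"
  shows "P s (P d f) x = P (s + d) f x"
proof -
  have "expectation (\<lambda>\<omega>. indicator (space M) \<omega> * f (X x (s + d) \<omega>)) =
    expectation (\<lambda>\<omega>. indicator (space M) \<omega> * P d f (X x s \<omega>))"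
    using sets.top[of "natural_filtration M B s"] by (intro markov[OF f s d]) simp
  then show ?thesis
    using s d by (simp add: P_eq_expectation[OF f] P_eq_expectation[OF P_lipschitz[OF f d]]
        cong: Bochner_Integration.integral_cong)
qed

lemma Q_Q:
  assumes f: "L-lipschitz_on UNIV f" and s: "0 \<le> s" and d: "0 \<le> d"
  shows "Q s (Q d f) x = Q (s + d) f x"
proof -
  have "P s (Q d f) x = exp (- r * d) * P s (P d f) x"
    by (simp add: P_def Q_def)
  then show ?thesis
    using P_P[OF assms, of x] by (simp add: Q_def exp_add[symmetric] mult.assoc[symmetric] algebra_simps)
qed

subsection \<open>Bermudan values\<close>

lemma put_gain_lipschitz: "1-lipschitz_on UNIV G"
  by (rule lipschitz_onI) (auto simp: put_gain_def dist_real_def max_def abs_if)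

lemma put_gain_convex: "convex_on UNIV G"
proof
  fix t x y :: real
  assume "0 < t" "t < 1"
  then have "(1 - t) * (K - x) \<le> (1 - t) * G x" "t * (K - y) \<le> t * G y" "0 \<le> (1 - t) * G x" "0 \<le> t * G y"
    by (auto simp: put_gain_def intro!: mult_left_mono mult_nonneg_nonneg)
  then show "G ((1 - t) *\<^sub>R x + t *\<^sub>R y) \<le> (1 - t) * G x + t * G y"
    unfolding put_gain_def[of K "(1 - t) *\<^sub>R x + t *\<^sub>R y"] by (simp add: algebra_simps)
qed auto

text \<open>Value of the put exercisable at the dates 0, \<delta>, ..., n \<delta>. The index counts
  the steps left, so at index 0 immediate exercise is the only choice.\<close>

primrec berm :: "real \<Rightarrow> nat \<Rightarrow> real \<Rightarrow> real" where
  "berm \<delta> 0 = G"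
| "berm \<delta> (Suc n) = (\<lambda>x. max (G x) (Q \<delta> (berm \<delta> n) x))"

lemma berm_lipschitz: "0 \<le> \<delta> \<Longrightarrow> 1-lipschitz_on UNIV (berm \<delta> n)"
  by (induction n) (auto intro!: lipschitz_max put_gain_lipschitz Q_lipschitz)

lemma berm_convex: "0 \<le> \<delta> \<Longrightarrow> convex_on UNIV (berm \<delta> n)"
  by (induction n) (auto intro!: convex_on_max put_gain_convex Q_convex berm_lipschitz)

lemma berm_ge: "G x \<le> berm \<delta> n x"
  by (cases n) auto

lemma put_gain_nonneg: "0 \<le> G x"
  by (simp add: put_gain_def)

lemma berm_le:
  assumes "0 \<le> \<delta>" "0 < x"
  shows "berm \<delta> n x \<le> K"
  using \<open>0 < x\<close>
proof (induction n arbitrary: x)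
  case (Suc n)
  have "Q \<delta> (berm \<delta> n) x \<le> Q \<delta> (\<lambda>_. K) x"
    by (rule Q_mono[OF berm_lipschitz[OF assms(1)] lipschitz_on_constant assms(1) Suc.IH Suc.prems])
  also have "\<dots> \<le> K"
    using r_pos K_pos assms(1) by (simp add: Q_def P_def gauss.prob_space[simplified])
  finally show ?case using Suc.prems K_pos by (simp add: put_gain_def)
qed (use K_pos in \<open>simp add: put_gain_def\<close>)

lemma berm_le_Suc:
  assumes "0 \<le> \<delta>" "0 < x"
  shows "berm \<delta> n x \<le> berm \<delta> (Suc n) x"
  using \<open>0 < x\<close>
proof (induction n arbitrary: x)
  case (Suc n)
  have "Q \<delta> (berm \<delta> n) x \<le> Q \<delta> (berm \<delta> (Suc n)) x"
    by (rule Q_mono[OF berm_lipschitz[OF assms(1)] berm_lipschitz[OF assms(1)] assms(1) Suc.IH Suc.prems])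
  then show ?case by (simp add: max.coboundedI2)
qed simp

lemma Q_0: "Q 0 f = f"
  by (simp add: Q_def P_def gauss.prob_space[simplified] fun_eq_iff)

text \<open>Waiting for \<open>m\<close> steps is one of the strategies over which the recursion
  maximises.\<close>

lemma Q_berm_le:
  assumes "0 \<le> \<delta>" "0 < x"
  shows "Q (m * \<delta>) (berm \<delta> k) x \<le> berm \<delta> (k + m) x"
  using \<open>0 < x\<close>
proof (induction m arbitrary: x)
  case (Suc m)
  note lip = berm_lipschitz[OF assms(1)]
  have "Q (real (Suc m) * \<delta>) (berm \<delta> k) x = Q \<delta> (Q (m * \<delta>) (berm \<delta> k)) x"
    using assms by (subst Q_Q[OF lip]) (auto simp: algebra_simps)
  also have "\<dots> \<le> Q \<delta> (berm \<delta> (k + m)) x"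
    using assms by (intro Q_mono[OF Q_lipschitz[OF lip] lip] Suc) auto
  also have "\<dots> \<le> berm \<delta> (k + Suc m) x" by simp
  finally show ?case .
qed (simp add: Q_0)

text \<open>Taking the maximum with \<open>G\<close> is nonexpansive, so each Bellman step passes
  the difference under \<open>Q\<close>, until only the gain of a single period over immediate
  exercise is left.\<close>

lemma berm_increment:
  assumes "0 \<le> \<delta>" "0 < x"
  shows "berm \<delta> (Suc n) x - berm \<delta> n x \<le> Q (n * \<delta>) (\<lambda>y. berm \<delta> 1 y - G y) x"
  using \<open>0 < x\<close>
proof (induction n arbitrary: x)
  case (Suc n)
  note lip = berm_lipschitz[OF assms(1)]
  note lip_diff = lipschitz_on_diff[OF lip lip] lipschitz_on_diff[OF lip put_gain_lipschitz]
  have "berm \<delta> (Suc (Suc n)) x - berm \<delta> (Suc n) x \<le> max 0 (Q \<delta> (berm \<delta> (Suc n)) x - Q \<delta> (berm \<delta> n) x)"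
    by (simp add: max_def)
  also have "\<dots> = Q \<delta> (berm \<delta> (Suc n)) x - Q \<delta> (berm \<delta> n) x"
    using Q_mono[OF lip lip assms(1) berm_le_Suc[OF assms(1)] Suc.prems] by simp
  also have "\<dots> = Q \<delta> (\<lambda>y. berm \<delta> (Suc n) y - berm \<delta> n y) x"
    by (rule Q_diff[OF lip lip assms(1), symmetric])
  also have "\<dots> \<le> Q \<delta> (Q (n * \<delta>) (\<lambda>y. berm \<delta> 1 y - G y)) x"
    using assms by (intro Q_mono[OF lip_diff(1) Q_lipschitz[OF lip_diff(2)]] Suc) auto
  also have "\<dots> = Q (real (Suc n) * \<delta>) (\<lambda>y. berm \<delta> 1 y - G y) x"
    using assms by (subst Q_Q[OF lip_diff(2)]) (auto simp: algebra_simps)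
  finally show ?case .
qed (simp add: Q_0)

lemma P_put:
  assumes "0 \<le> d"
  shows "P d (\<lambda>y. max (K - c * y) 0) x =
    (\<integral>z. max (K - (c * x * exp (r * d)) * exp ((\<sigma> * sqrt d) * z - (\<sigma> * sqrt d)\<^sup>2 / 2)) 0 \<partial>gauss)"
  using assms by (simp add: P_def growth_eq mult.assoc)

text \<open>By \<open>berm_increment\<close> only the last period matters. Bounding its discounted
  strike by \<open>K\<close> leaves an undiscounted put on the discounted price, and the increment
  becomes a difference of two European puts that \<open>put_volatility_increment\<close>
  controls.\<close>

lemma berm_step_le:
  fixes \<delta> x :: real
  assumes "0 \<le> \<delta>" "0 < x"
  shows "berm \<delta> (Suc n) x - berm \<delta> n x \<le> x * \<sigma> * (sqrt (Suc n * \<delta>) - sqrt (n * \<delta>))"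
proof -
  define v where "v = n * \<delta>"
  have v: "0 \<le> v" "Suc n * \<delta> = v + \<delta>" using assms by (auto simp: v_def algebra_simps)
  define g where "g y = max (K - exp (- r * \<delta>) * y) 0" for y
  have g_lip: "1-lipschitz_on UNIV g"
  proof (rule lipschitz_onI)
    fix y y' :: real
    have "exp (- r * \<delta>) \<le> 1" using r_pos assms by simp
    then have "exp (- r * \<delta>) * \<bar>y - y'\<bar> \<le> 1 * \<bar>y - y'\<bar>" by (intro mult_right_mono) auto
    moreover have "exp (- r * \<delta>) * \<bar>y - y'\<bar> = \<bar>exp (- r * \<delta>) * y - exp (- r * \<delta>) * y'\<bar>"
      by (simp add: abs_mult right_diff_distrib[symmetric])
    ultimately show "dist (g y) (g y') \<le> 1 * dist y y'"
      by (simp add: g_def dist_real_def)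
  qed simp
  have le: "berm \<delta> 1 y - G y \<le> P \<delta> g y - G y" if "0 < y" for y
  proof -
    have "Q \<delta> G y = (\<integral>z. exp (- r * \<delta>) * G (y * growth \<delta> z) \<partial>gauss)"
      by (simp add: Q_def P_def)
    also have "\<dots> \<le> P \<delta> g y"
      unfolding P_def
    proof (rule integral_mono)
      fix z
      have e: "exp (- r * \<delta>) \<le> 1" using r_pos assms by simp
      have "exp (- r * \<delta>) * G (y * growth \<delta> z) = max (exp (- r * \<delta>) * K - exp (- r * \<delta>) * (y * growth \<delta> z)) 0"
        by (simp add: put_gain_def max_mult_distrib_left right_diff_distrib)
      also have "\<dots> \<le> g (y * growth \<delta> z)"
        unfolding g_def using mult_right_mono[OF e, of K] K_pos by (intro max.mono) linarith+
      finally show "exp (- r * \<delta>) * G (y * growth \<delta> z) \<le> g (y * growth \<delta> z)" .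
    qed (use assms in \<open>auto intro!: integrable_lipschitz_growth put_gain_lipschitz g_lip\<close>)
    finally have 1: "Q \<delta> G y \<le> P \<delta> g y" .
    \<comment> \<open>Jensen for \<open>g\<close>: its linear part has mean \<open>K - y\<close>,
      because the discounted price has mean \<open>y\<close>.\<close>
    have "(\<integral>z. K - exp (- r * \<delta>) * (y * growth \<delta> z) \<partial>gauss) \<le> P \<delta> g y"
      unfolding P_def using assms integrable_growth[of \<delta>]
      by (intro integral_mono integrable_lipschitz_growth[OF g_lip]) (auto simp: g_def)
    moreover have "(\<integral>z. K - exp (- r * \<delta>) * (y * growth \<delta> z) \<partial>gauss) = K - exp (- r * \<delta>) * (y * exp (r * \<delta>))"
      using integrable_growth[of \<delta>] integral_growth[of \<delta>] assms by (simp add: gauss.prob_space[simplified])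
    moreover have "exp (- r * \<delta>) * (y * exp (r * \<delta>)) = y"
      by (simp add: exp_minus)
    moreover have "0 \<le> P \<delta> g y"
      unfolding P_def by (rule Bochner_Integration.integral_nonneg) (simp add: g_def)
    ultimately have "G y \<le> P \<delta> g y"
      unfolding put_gain_def by (intro max.boundedI) linarith+
    with 1 show ?thesis by simp
  qed
  note lip_diff = lipschitz_on_diff[OF berm_lipschitz[OF assms(1)] put_gain_lipschitz]
    lipschitz_on_diff[OF P_lipschitz[OF g_lip assms(1)] put_gain_lipschitz]
  have "berm \<delta> (Suc n) x - berm \<delta> n x \<le> Q v (\<lambda>y. berm \<delta> 1 y - G y) x"
    unfolding v_def by (rule berm_increment[OF assms])
  also have "\<dots> \<le> Q v (\<lambda>y. P \<delta> g y - G y) x"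
    by (rule Q_mono[OF lip_diff v(1) le assms(2)])
  also have "\<dots> = exp (- r * v) * (P (v + \<delta>) g x - P v G x)"
    unfolding Q_def using assms v
    by (subst P_diff[OF P_lipschitz[OF g_lip] put_gain_lipschitz]) (auto simp: P_P[OF g_lip])
  also have "\<dots> \<le> exp (- r * v) * ((x * exp (r * v)) * (\<sigma> * sqrt (v + \<delta>) - \<sigma> * sqrt v))"
  proof (intro mult_left_mono)
    \<comment> \<open>Both puts have the forward price \<open>x * exp (r * v)\<close>, so they
      differ in volatility alone; the discount in front later cancels the factor
      \<open>exp (r * v)\<close>.\<close>
    have e: "exp (- r * \<delta>) * x * exp (r * (v + \<delta>)) = x * exp (r * v)"
      by (simp add: exp_add distrib_left exp_minus)
    have "P v G x = P v (\<lambda>y. max (K - 1 * y) 0) x"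
      by (simp add: P_def put_gain_def)
    then show "P (v + \<delta>) g x - P v G x \<le> (x * exp (r * v)) * (\<sigma> * sqrt (v + \<delta>) - \<sigma> * sqrt v)"
      using put_volatility_increment[of "x * exp (r * v)" "\<sigma> * sqrt v" "\<sigma> * sqrt (v + \<delta>)" K]
        assms \<sigma>_pos v P_put[of "v + \<delta>" "exp (- r * \<delta>)" x] P_put[of v 1 x]
      by (simp only: g_def[abs_def] e) simp
  qed simp
  also have "\<dots> = x * \<sigma> * (sqrt (v + \<delta>) - sqrt v)"
    by (simp add: exp_minus field_simps)
  finally show ?thesis unfolding v(2) by (simp add: v_def)
qed

text \<open>The one-step bounds telescope, so the mesh enters only through the two horizons.\<close>

lemma berm_time_le:
  fixes \<delta> x :: real
  assumes "0 \<le> \<delta>" "0 < x"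
  shows "berm \<delta> (k + m) x - berm \<delta> k x \<le> x * \<sigma> * (sqrt ((k + m) * \<delta>) - sqrt (k * \<delta>))"
proof (induction m)
  case (Suc m)
  then show ?case
    using berm_step_le[OF assms, of "k + m"] by (simp add: algebra_simps del: berm.simps)
qed simp


subsection \<open>Bermudan approximation of the value function\<close>

definition payoff :: "real \<Rightarrow> real \<Rightarrow> 'a \<Rightarrow> real" where
  "payoff x t \<omega> = exp (- r * t) * G (X x t \<omega>)"

text \<open>The first argument of \<open>val\<close> is the time to maturity \<open>T - t\<close>.\<close>

definition val :: "real \<Rightarrow> real \<Rightarrow> real" where
  "val u x = (SUP \<tau>\<in>stopping_times_upto M (X x) u. expectation (\<lambda>\<omega>. payoff x (\<tau> \<omega>) \<omega>))"

text \<open>Upper bounds are proved in the filtration of \<open>B\<close>, from which the increments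
  are independent; strategies attaining the grid value are built in the filtration of the price, as
  the definition of the value demands. This inclusion joins the two.\<close>

lemma sets_natural_filtration_gbm_subset:
  "sets (natural_filtration M (X x) t) \<subseteq> sets (natural_filtration M B t)"
  unfolding sets_natural_filtration[of M "X x"]
proof (rule sets.sigma_sets_subset[of _ "natural_filtration M B t", unfolded space_natural_filtration])
  show "{X x s -` A \<inter> space M | s A. 0 \<le> s \<and> s \<le> t \<and> A \<in> sets borel} \<subseteq> sets (natural_filtration M B t)"
    using measurable_sets[OF borel_measurable_gbm_natural_filtration] by auto
qed

lemma borel_measurable_payoff: "0 \<le> t \<Longrightarrow> random_variable borel (payoff x t)"
  unfolding payoff_def[abs_def]
  using borel_measurable_gbm lipschitz_borel_measurable[OF put_gain_lipschitz] by measurable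

lemma payoff_nonneg: "0 \<le> payoff x t \<omega>"
  by (simp add: payoff_def put_gain_nonneg)

lemma payoff_le: "0 < x \<Longrightarrow> 0 \<le> t \<Longrightarrow> payoff x t \<omega> \<le> K"
  using mult_mono[of "exp (- r * t)" 1 "G (X x t \<omega>)" K] gbm_pos[of x t \<omega>] r_pos K_pos
  by (simp add: payoff_def put_gain_def)

lemma continuous_on_payoff: "\<omega> \<in> space M \<Longrightarrow> continuous_on {0..} (\<lambda>t. payoff x t \<omega>)"
  unfolding payoff_def put_gain_def gbm_def
  using continuous_paths[of \<omega>] by (intro continuous_intros)

lemma borel_measurable_grid_payoff:
  fixes \<kappa> :: "'a \<Rightarrow> nat" and \<delta> :: real
  assumes "0 \<le> \<delta>" and \<kappa>: "\<And>k. {\<omega> \<in> space M. \<kappa> \<omega> \<le> k} \<in> events"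
  shows "random_variable borel (\<lambda>\<omega>. payoff x (\<kappa> \<omega> * \<delta>) \<omega>)"
proof (rule measurable_compose_countable[of "\<lambda>k. payoff x (real k * \<delta>)" M borel \<kappa>])
  show "random_variable borel (payoff x (real k * \<delta>))" for k
    using assms by (intro borel_measurable_payoff) auto
  have "\<kappa> -` {k} \<inter> space M \<in> events" for k
  proof (cases k)
    case 0
    then have "\<kappa> -` {k} \<inter> space M = {\<omega> \<in> space M. \<kappa> \<omega> \<le> 0}" by auto
    then show ?thesis using \<kappa>[of 0] by (simp only:)
  next
    case (Suc m)
    then have "\<kappa> -` {k} \<inter> space M = {\<omega> \<in> space M. \<kappa> \<omega> \<le> k} - {\<omega> \<in> space M. \<kappa> \<omega> \<le> m}" by auto
    then show ?thesis using \<kappa> by auto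
  qed
  then show "\<kappa> \<in> M \<rightarrow>\<^sub>M count_space UNIV"
    by (simp add: measurable_count_space_eq2_countable)
qed

lemma integrable_grid_payoff:
  fixes \<kappa> :: "'a \<Rightarrow> nat" and \<delta> :: real
  assumes "0 \<le> \<delta>" "0 < x" and "\<And>k. {\<omega> \<in> space M. \<kappa> \<omega> \<le> k} \<in> events"
  shows "integrable M (\<lambda>\<omega>. payoff x (\<kappa> \<omega> * \<delta>) \<omega>)"
proof (rule integrable_const_bound[of _ K])
  show "AE \<omega> in M. norm (payoff x (\<kappa> \<omega> * \<delta>) \<omega>) \<le> K"
    using assms payoff_le payoff_nonneg by auto
qed (rule borel_measurable_grid_payoff[OF assms(1,3)])

lemma markov_Q:
  assumes f: "L-lipschitz_on UNIV f" and s: "0 \<le> s" and d: "0 \<le> d"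
    and A: "A \<in> sets (natural_filtration M B s)"
  shows "expectation (\<lambda>\<omega>. indicator A \<omega> * (exp (- r * (s + d)) * f (X x (s + d) \<omega>))) =
    expectation (\<lambda>\<omega>. indicator A \<omega> * (exp (- r * s) * Q d f (X x s \<omega>)))"
proof -
  have "expectation (\<lambda>\<omega>. indicator A \<omega> * (exp (- r * (s + d)) * f (X x (s + d) \<omega>))) =
      exp (- r * (s + d)) * expectation (\<lambda>\<omega>. indicator A \<omega> * f (X x (s + d) \<omega>))"
    by (subst integral_mult_right_zero[symmetric]) (simp add: ac_simps)
  also have "\<dots> = exp (- r * (s + d)) * expectation (\<lambda>\<omega>. indicator A \<omega> * P d f (X x s \<omega>))"
    by (simp only: markov[OF assms])
  also have "\<dots> = expectation (\<lambda>\<omega>. indicator A \<omega> * (exp (- r * s) * Q d f (X x s \<omega>)))"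
  proof -
    have "exp (- r * (s + d)) = exp (- r * s) * exp (- r * d)"
      by (simp only: exp_add[symmetric] distrib_left)
    then show ?thesis
      by (subst integral_mult_right_zero[symmetric]) (simp add: Q_def ac_simps)
  qed
  finally show ?thesis .
qed

lemma integrable_indicator_mult:
  fixes f :: "'a \<Rightarrow> real"
  shows "A \<in> events \<Longrightarrow> integrable M f \<Longrightarrow> integrable M (\<lambda>\<omega>. indicator A \<omega> * f \<omega>)"
  using integrable_real_mult_indicator[of A M f] by (simp add: mult.commute)

text \<open>Backward induction over the number \<open>j\<close> of steps left, restricted to the
  event that stopping has not occurred before date \<open>N - j\<close>. At each date the event
  splits: where one stops now, \<open>berm\<close> dominates the gain; elsewhere the Markov property
  moves to the next date.\<close>

lemma grid_payoff_le_berm: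
  fixes \<kappa> :: "'a \<Rightarrow> nat" and \<delta> :: real
  assumes \<delta>: "0 \<le> \<delta>" and x: "0 < x"
    and \<kappa>: "\<And>k. {\<omega> \<in> space M. \<kappa> \<omega> \<le> k} \<in> sets (natural_filtration M B (k * \<delta>))"
    and le: "\<And>\<omega>. \<omega> \<in> space M \<Longrightarrow> \<kappa> \<omega> \<le> N"
  shows "expectation (\<lambda>\<omega>. payoff x (\<kappa> \<omega> * \<delta>) \<omega>) \<le> berm \<delta> N x"
proof -
  define Y where "Y j \<omega> = exp (- r * (real (N - j) * \<delta>)) * berm \<delta> j (X x (real (N - j) * \<delta>) \<omega>)" for j \<omega>
  define A where "A k = {\<omega> \<in> space M. k \<le> \<kappa> \<omega>}" for k
  have \<kappa>M: "{\<omega> \<in> space M. \<kappa> \<omega> \<le> k} \<in> events" for k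
    using \<kappa> sets_natural_filtration_subset by blast
  \<comment> \<open>Whether one continues past date \<open>k\<close> is already known at date
    \<open>k\<close>; this is what admits the Markov step.\<close>
  have A_F: "A (Suc k) \<in> sets (natural_filtration M B (k * \<delta>))" for k
  proof -
    have "A (Suc k) = space (natural_filtration M B (k * \<delta>)) - {\<omega> \<in> space M. \<kappa> \<omega> \<le> k}"
      by (auto simp: A_def)
    then show ?thesis using \<kappa>[of k] by (auto simp del: space_natural_filtration)
  qed
  have A_M: "A k \<in> events" for k
  proof (cases k)
    case 0
    then have "A k = space M" by (auto simp: A_def)
    then show ?thesis by simp
  next
    case (Suc m)
    then show ?thesis using A_F[of m] sets_natural_filtration_subset by blast
  qed
  have intY: "integrable M (Y j)" for j
    unfolding Y_def[abs_def] using \<delta>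
    by (intro integrable_mult_right integrable_lipschitz_gbm[OF berm_lipschitz]) auto
  have int\<kappa>: "integrable M (\<lambda>\<omega>. payoff x (\<kappa> \<omega> * \<delta>) \<omega>)"
    by (rule integrable_grid_payoff[OF \<delta> x \<kappa>M])
  note int = integrable_indicator_mult[OF A_M intY] integrable_indicator_mult[OF A_M int\<kappa>]
  have "expectation (\<lambda>\<omega>. indicator (A (N - j)) \<omega> * payoff x (\<kappa> \<omega> * \<delta>) \<omega>)
     \<le> expectation (\<lambda>\<omega>. indicator (A (N - j)) \<omega> * Y j \<omega>)" if "j \<le> N" for j
    using that
  proof (induction j)
    case 0
    show ?case
    proof (rule integral_mono[OF int(2) int(1)])
      fix \<omega> assume "\<omega> \<in> space M"
      then show "indicator (A (N - 0)) \<omega> * payoff x (\<kappa> \<omega> * \<delta>) \<omega> \<le> indicator (A (N - 0)) \<omega> * Y 0 \<omega>"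
        using le[of \<omega>] by (auto simp: A_def Y_def payoff_def split: split_indicator)
    qed
  next
    case (Suc j)
    define k where "k = N - Suc j"
    have k: "N - j = Suc k" "N - Suc j = k"
      using Suc.prems by (auto simp: k_def of_nat_diff)
    let ?E = "A k - A (Suc k)" and ?C = "A (Suc k)"
    let ?q = "\<lambda>\<omega>. exp (- r * (k * \<delta>)) * Q \<delta> (berm \<delta> j) (X x (k * \<delta>) \<omega>)"
    have E_M: "?E \<in> events" using A_M by auto
    have intq: "integrable M ?q"
      using \<delta> by (intro integrable_mult_right integrable_lipschitz_gbm[OF Q_lipschitz[OF berm_lipschitz]]) auto
    have split: "indicator (A k) \<omega> * f = indicator ?E \<omega> * f + indicator ?C \<omega> * f" for \<omega> and f :: real
      by (auto simp: A_def split: split_indicator)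
    have "expectation (\<lambda>\<omega>. indicator ?E \<omega> * payoff x (\<kappa> \<omega> * \<delta>) \<omega>)
        \<le> expectation (\<lambda>\<omega>. indicator ?E \<omega> * Y (Suc j) \<omega>)"
    proof (rule integral_mono[OF integrable_indicator_mult[OF E_M int\<kappa>] integrable_indicator_mult[OF E_M intY]])
      fix \<omega> assume "\<omega> \<in> space M"
      show "indicator ?E \<omega> * payoff x (\<kappa> \<omega> * \<delta>) \<omega> \<le> indicator ?E \<omega> * Y (Suc j) \<omega>"
      proof (cases "\<omega> \<in> ?E")
        case True
        then have "\<kappa> \<omega> = k" by (auto simp: A_def)
        then show ?thesis
          using True berm_ge[of "X x (k * \<delta>) \<omega>" \<delta> "Suc j"]
          by (simp add: payoff_def Y_def k(2) del: of_nat_Suc berm.simps)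
      qed simp
    qed
    moreover have "expectation (\<lambda>\<omega>. indicator ?C \<omega> * payoff x (\<kappa> \<omega> * \<delta>) \<omega>)
        \<le> expectation (\<lambda>\<omega>. indicator ?C \<omega> * Y (Suc j) \<omega>)"
    proof -
      have "expectation (\<lambda>\<omega>. indicator ?C \<omega> * payoff x (\<kappa> \<omega> * \<delta>) \<omega>) \<le> expectation (\<lambda>\<omega>. indicator ?C \<omega> * Y j \<omega>)"
        using Suc by (simp add: k)
      also have "\<dots> = expectation (\<lambda>\<omega>. indicator ?C \<omega> * (exp (- r * (k * \<delta> + \<delta>)) * berm \<delta> j (X x (k * \<delta> + \<delta>) \<omega>)))"
        unfolding Y_def k(1) by (simp add: algebra_simps)
      also have "\<dots> = expectation (\<lambda>\<omega>. indicator ?C \<omega> * ?q \<omega>)"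
        using \<delta> by (intro markov_Q[OF berm_lipschitz] A_F) auto
      also have "\<dots> \<le> expectation (\<lambda>\<omega>. indicator ?C \<omega> * Y (Suc j) \<omega>)"
        by (rule integral_mono[OF integrable_indicator_mult[OF A_M intq] int(1)])
           (auto simp: Y_def k(2) simp del: of_nat_Suc split: split_indicator)
      finally show ?thesis .
    qed
    ultimately have "expectation (\<lambda>\<omega>. indicator (A k) \<omega> * payoff x (\<kappa> \<omega> * \<delta>) \<omega>)
        \<le> expectation (\<lambda>\<omega>. indicator (A k) \<omega> * Y (Suc j) \<omega>)"
      unfolding split
      by (subst (1 2) Bochner_Integration.integral_add)
         (intro integrable_indicator_mult E_M A_M int\<kappa> intY, intro integrable_indicator_mult E_M A_M int\<kappa> intY,
          intro integrable_indicator_mult E_M A_M int\<kappa> intY, intro integrable_indicator_mult E_M A_M int\<kappa> intY, linarith)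
    then show ?case by (simp add: k_def)
  qed
  from this[of N] have "expectation (\<lambda>\<omega>. payoff x (\<kappa> \<omega> * \<delta>) \<omega>) \<le> expectation (Y N)"
    by (simp add: A_def cong: Bochner_Integration.integral_cong)
  also have "expectation (Y N) = expectation (\<lambda>_. berm \<delta> N x)"
    using start_zero by (intro Bochner_Integration.integral_cong) (auto simp: Y_def gbm_def)
  finally show ?thesis by (simp add: prob_space)
qed

text \<open>The strategy exercises at the first date at which the gain is no less than the
  continuation value. The inequality is claimed on every past event so that the induction step can
  restrict it to \<open>A - D\<close>, where waiting is better.\<close>

lemma grid_optimal_stopping:
  fixes \<delta> x :: real
  assumes \<delta>: "0 \<le> \<delta>" and x: "0 < x" and "j \<le> N"
  shows "\<exists>\<kappa> :: 'a \<Rightarrow> nat. (\<forall>\<omega>. N - j \<le> \<kappa> \<omega> \<and> \<kappa> \<omega> \<le> N) \<and>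
    (\<forall>k. {\<omega> \<in> space M. \<kappa> \<omega> \<le> k} \<in> sets (natural_filtration M (X x) (k * \<delta>))) \<and>
    (\<forall>A \<in> sets (natural_filtration M (X x) (real (N - j) * \<delta>)).
      expectation (\<lambda>\<omega>. indicator A \<omega> * (exp (- r * (real (N - j) * \<delta>)) * berm \<delta> j (X x (real (N - j) * \<delta>) \<omega>)))
      \<le> expectation (\<lambda>\<omega>. indicator A \<omega> * payoff x (\<kappa> \<omega> * \<delta>) \<omega>))"
  using \<open>j \<le> N\<close>
proof (induction j)
  case 0
  have "{\<omega> \<in> space M. N \<le> k} \<in> sets (natural_filtration M (X x) (k * \<delta>))" for k
    using sets.top[of "natural_filtration M (X x) (k * \<delta>)"] by (cases "N \<le> k") simp_all
  then have "\<forall>k. {\<omega> \<in> space M. N \<le> k} \<in> sets (natural_filtration M (X x) (k * \<delta>))" ..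
  note F = this
  show ?case
  proof (rule exI[of _ "\<lambda>_. N"], intro conjI)
    show "\<forall>k. {\<omega> \<in> space M. N \<le> k} \<in> sets (natural_filtration M (X x) (k * \<delta>))" by (rule F)
  qed (simp_all add: payoff_def)
next
  case (Suc j)
  define k where "k = N - Suc j"
  have k: "N - j = Suc k" "N - Suc j = k" "k \<le> N"
    using Suc.prems by (auto simp: k_def of_nat_diff)
  let ?F = "\<lambda>k. sets (natural_filtration M (X x) (real k * \<delta>))"
  have F_mono: "?F m \<subseteq> ?F m'" if "m \<le> m'" for m m'
    using that \<delta> by (intro sets_natural_filtration_mono mult_right_mono) auto
  have F_M: "?F m \<subseteq> events" for m
    using sets_natural_filtration_gbm_subset sets_natural_filtration_subset by blast
  obtain \<kappa> :: "'a \<Rightarrow> nat" where \<kappa>: "\<And>\<omega>. Suc k \<le> \<kappa> \<omega>" "\<And>\<omega>. \<kappa> \<omega> \<le> N"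
    "\<And>m. {\<omega> \<in> space M. \<kappa> \<omega> \<le> m} \<in> ?F m"
    "\<And>A. A \<in> ?F (Suc k) \<Longrightarrow>
      expectation (\<lambda>\<omega>. indicator A \<omega> * (exp (- r * (Suc k * \<delta>)) * berm \<delta> j (X x (Suc k * \<delta>) \<omega>)))
      \<le> expectation (\<lambda>\<omega>. indicator A \<omega> * payoff x (\<kappa> \<omega> * \<delta>) \<omega>)"
    using Suc by (auto simp: k simp del: of_nat_Suc)
  let ?q = "\<lambda>\<omega>. Q \<delta> (berm \<delta> j) (X x (k * \<delta>) \<omega>)" and ?g = "\<lambda>\<omega>. G (X x (k * \<delta>) \<omega>)"
  define D where "D = {\<omega> \<in> space M. ?q \<omega> \<le> ?g \<omega>}"
  note lipQ = Q_lipschitz[OF berm_lipschitz[OF \<delta>] \<delta>]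
  have D_F: "D \<in> ?F k"
  proof -
    have [measurable]: "X x (k * \<delta>) \<in> borel_measurable (natural_filtration M (X x) (k * \<delta>))"
      using \<delta> by (intro measurable_natural_filtration) auto
    have [measurable]: "Q \<delta> (berm \<delta> j) \<in> borel_measurable borel" "G \<in> borel_measurable borel"
      using lipschitz_borel_measurable lipQ put_gain_lipschitz by auto
    have "{\<omega> \<in> space (natural_filtration M (X x) (k * \<delta>)). ?q \<omega> \<le> ?g \<omega>} \<in> ?F k"
      by measurable
    then show ?thesis by (simp add: D_def)
  qed
  \<comment> \<open>Exercise now on \<open>D\<close>, otherwise follow the strategy of the shorter
    problem.\<close>
  define \<kappa>' where "\<kappa>' \<omega> = (if \<omega> \<in> D then k else \<kappa> \<omega>)" for \<omega>
  have \<kappa>'_F: "{\<omega> \<in> space M. \<kappa>' \<omega> \<le> m} \<in> ?F m" for m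
  proof (cases "k \<le> m")
    case True
    then have "{\<omega> \<in> space M. \<kappa>' \<omega> \<le> m} = D \<union> ({\<omega> \<in> space M. \<kappa> \<omega> \<le> m} - D)"
      by (auto simp: \<kappa>'_def D_def)
    moreover have "D \<in> ?F m" using D_F F_mono[OF True] by auto
    ultimately show ?thesis using \<kappa>(3)[of m] by auto
  next
    case False
    then have "{\<omega> \<in> space M. \<kappa>' \<omega> \<le> m} = {}"
      using \<kappa>(1) by (auto simp: \<kappa>'_def) (metis Suc_leD le_trans)
    then show ?thesis by (simp only: sets.empty_sets)
  qed
  have "expectation (\<lambda>\<omega>. indicator A \<omega> * (exp (- r * (k * \<delta>)) * berm \<delta> (Suc j) (X x (k * \<delta>) \<omega>)))
      \<le> expectation (\<lambda>\<omega>. indicator A \<omega> * payoff x (\<kappa>' \<omega> * \<delta>) \<omega>)" if A: "A \<in> ?F k" for A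
  proof -
    have ADF: "A \<inter> D \<in> ?F k" "A - D \<in> ?F k" using A D_F by auto
    then have AD: "A \<inter> D \<in> events" "A - D \<in> events" using F_M by auto
    have int1: "integrable M (\<lambda>\<omega>. indicator (A \<inter> D) \<omega> * payoff x (k * \<delta>) \<omega>)"
      unfolding payoff_def using \<delta>
      by (intro integrable_indicator_mult AD integrable_mult_right integrable_lipschitz_gbm[OF put_gain_lipschitz]) auto
    have int2: "integrable M (\<lambda>\<omega>. indicator (A - D) \<omega> * (exp (- r * (k * \<delta>)) * ?q \<omega>))"
      using \<delta> by (intro integrable_indicator_mult AD integrable_mult_right integrable_lipschitz_gbm[OF lipQ]) auto
    have int3: "integrable M (\<lambda>\<omega>. indicator (A - D) \<omega> * payoff x (\<kappa> \<omega> * \<delta>) \<omega>)"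
      using \<kappa>(3) F_M by (intro integrable_indicator_mult AD integrable_grid_payoff[OF \<delta> x]) auto
    have "expectation (\<lambda>\<omega>. indicator A \<omega> * (exp (- r * (k * \<delta>)) * berm \<delta> (Suc j) (X x (k * \<delta>) \<omega>)))
      = expectation (\<lambda>\<omega>. indicator (A \<inter> D) \<omega> * payoff x (k * \<delta>) \<omega> +
           indicator (A - D) \<omega> * (exp (- r * (k * \<delta>)) * ?q \<omega>))"
      by (intro Bochner_Integration.integral_cong) (auto simp: D_def payoff_def split: split_indicator)
    also have "\<dots> = expectation (\<lambda>\<omega>. indicator (A \<inter> D) \<omega> * payoff x (k * \<delta>) \<omega>) +
        expectation (\<lambda>\<omega>. indicator (A - D) \<omega> * (exp (- r * (k * \<delta>)) * ?q \<omega>))"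
      by (rule Bochner_Integration.integral_add[OF int1 int2])
    also have "\<dots> \<le> expectation (\<lambda>\<omega>. indicator (A \<inter> D) \<omega> * payoff x (k * \<delta>) \<omega>) +
      expectation (\<lambda>\<omega>. indicator (A - D) \<omega> * payoff x (\<kappa> \<omega> * \<delta>) \<omega>)"
    proof (rule add_left_mono)
      have "expectation (\<lambda>\<omega>. indicator (A - D) \<omega> * (exp (- r * (k * \<delta>)) * ?q \<omega>)) =
        expectation (\<lambda>\<omega>. indicator (A - D) \<omega> * (exp (- r * (k * \<delta> + \<delta>)) * berm \<delta> j (X x (k * \<delta> + \<delta>) \<omega>)))"
        using \<delta> ADF sets_natural_filtration_gbm_subset by (intro markov_Q[OF berm_lipschitz, symmetric]) auto
      also have "\<dots> \<le> expectation (\<lambda>\<omega>. indicator (A - D) \<omega> * payoff x (\<kappa> \<omega> * \<delta>) \<omega>)"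
        using \<kappa>(4)[of "A - D"] ADF F_mono[of k "Suc k"] by (auto simp: algebra_simps)
      finally show "expectation (\<lambda>\<omega>. indicator (A - D) \<omega> * (exp (- r * (k * \<delta>)) * ?q \<omega>))
        \<le> expectation (\<lambda>\<omega>. indicator (A - D) \<omega> * payoff x (\<kappa> \<omega> * \<delta>) \<omega>)" .
    qed
    also have "\<dots> =
      expectation (\<lambda>\<omega>. indicator (A \<inter> D) \<omega> * payoff x (k * \<delta>) \<omega> + indicator (A - D) \<omega> * payoff x (\<kappa> \<omega> * \<delta>) \<omega>)"
      by (rule Bochner_Integration.integral_add[OF int1 int3, symmetric])
    also have "\<dots> = expectation (\<lambda>\<omega>. indicator A \<omega> * payoff x (\<kappa>' \<omega> * \<delta>) \<omega>)"
      by (intro Bochner_Integration.integral_cong) (auto simp: \<kappa>'_def split: split_indicator)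
    finally show ?thesis .
  qed
  moreover have "N - Suc j \<le> \<kappa>' \<omega> \<and> \<kappa>' \<omega> \<le> N" for \<omega>
    using \<kappa>(1,2)[of \<omega>] k by (auto simp: \<kappa>'_def)
  ultimately show ?case
    using \<kappa>'_F by (intro exI[of _ \<kappa>']) (simp add: k del: of_nat_Suc berm.simps)
qed

section \<open>Stopping in continuous time against stopping on a grid\<close>

lemma stopping_times_upto_bounds:
  "\<tau> \<in> stopping_times_upto M Z u \<Longrightarrow> \<omega> \<in> space M \<Longrightarrow> 0 \<le> \<tau> \<omega> \<and> \<tau> \<omega> \<le> u"
  by (simp add: stopping_times_upto_def)

text \<open>A stopping time is rounded up to the grid; rounding up, unlike down, preserves
  adaptedness. Path continuity and the bound \<open>K\<close> give convergence of the expected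
  payoffs, and measurability of the stopped payoff comes as a limit as well.\<close>

lemma
  assumes \<tau>: "\<tau> \<in> stopping_times_upto M (X x) u" and u: "0 < u" and x: "0 < x"
  shows borel_measurable_payoff_stopping: "random_variable borel (\<lambda>\<omega>. payoff x (\<tau> \<omega>) \<omega>)"
    and eventually_expectation_payoff_less_berm: "e > 0 \<Longrightarrow> \<forall>\<^sub>F N in sequentially.
      expectation (\<lambda>\<omega>. payoff x (\<tau> \<omega>) \<omega>) - e < berm (u / N) N x"
proof -
  \<comment> \<open>\<open>Suc N\<close> keeps the mesh positive at N = 0; the end of the proof
    shifts the index back.\<close>
  define \<delta> where "\<delta> N = u / Suc N" for N
  define \<kappa> where "\<kappa> N \<omega> = nat \<lceil>\<tau> \<omega> / \<delta> N\<rceil>" for N \<omega>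
  have \<delta>: "0 < \<delta> N" for N using u by (simp add: \<delta>_def)
  have \<tau>_bd: "0 \<le> \<tau> \<omega>" "\<tau> \<omega> \<le> u" if "\<omega> \<in> space M" for \<omega>
    using stopping_times_upto_bounds[OF \<tau> that] by auto
  have \<kappa>_le: "\<kappa> N \<omega> \<le> k \<longleftrightarrow> \<tau> \<omega> \<le> k * \<delta> N" for N k \<omega>
    using \<delta>[of N] by (simp add: \<kappa>_def nat_le_iff ceiling_le_iff divide_le_eq)
  have \<kappa>_F: "{\<omega> \<in> space M. \<kappa> N \<omega> \<le> k} \<in> sets (natural_filtration M B (k * \<delta> N))" for N k
  proof -
    have "{\<omega> \<in> space M. \<tau> \<omega> \<le> k * \<delta> N} \<in> sets (natural_filtration M (X x) (k * \<delta> N))"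
      using stopping_timeD[of "natural_filtration M (X x)" \<tau> "k * \<delta> N"] \<tau>
      by (simp add: stopping_times_upto_def pred_def)
    then show ?thesis using sets_natural_filtration_gbm_subset unfolding \<kappa>_le by blast
  qed
  have \<kappa>_M: "{\<omega> \<in> space M. \<kappa> N \<omega> \<le> k} \<in> events" for N k
    using \<kappa>_F sets_natural_filtration_subset by blast
  have meas: "random_variable borel (\<lambda>\<omega>. payoff x (\<kappa> N \<omega> * \<delta> N) \<omega>)" for N
    using \<delta>[of N] \<kappa>_M by (intro borel_measurable_grid_payoff) auto
  have lim: "(\<lambda>N. payoff x (\<kappa> N \<omega> * \<delta> N) \<omega>) \<longlonglongrightarrow> payoff x (\<tau> \<omega>) \<omega>" if \<omega>: "\<omega> \<in> space M" for \<omega>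
  proof -
    have "(\<lambda>N. \<kappa> N \<omega> * \<delta> N) \<longlonglongrightarrow> \<tau> \<omega>"
    proof (rule tendsto_sandwich[of "\<lambda>_. \<tau> \<omega>" _ _ "\<lambda>N. \<tau> \<omega> + \<delta> N"])
      show "\<forall>\<^sub>F N in sequentially. \<tau> \<omega> \<le> \<kappa> N \<omega> * \<delta> N"
        using \<kappa>_le by (intro always_eventually) auto
      show "\<forall>\<^sub>F N in sequentially. \<kappa> N \<omega> * \<delta> N \<le> \<tau> \<omega> + \<delta> N"
      proof (intro always_eventually allI)
        fix N
        have "real (\<kappa> N \<omega>) \<le> \<tau> \<omega> / \<delta> N + 1"
          using \<tau>_bd[OF \<omega>] \<delta>[of N] by (simp add: \<kappa>_def)
        then have "\<kappa> N \<omega> * \<delta> N \<le> (\<tau> \<omega> / \<delta> N + 1) * \<delta> N"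
          using \<delta>[of N] by (intro mult_right_mono) auto
        then show "\<kappa> N \<omega> * \<delta> N \<le> \<tau> \<omega> + \<delta> N"
          using \<delta>[of N] by (simp add: distrib_right)
      qed
      have "\<delta> \<longlonglongrightarrow> 0" unfolding \<delta>_def[abs_def]
        by (rule LIMSEQ_Suc) (rule lim_const_over_n)
      then show "(\<lambda>N. \<tau> \<omega> + \<delta> N) \<longlonglongrightarrow> \<tau> \<omega>"
        using tendsto_add[of "\<lambda>_. \<tau> \<omega>" "\<tau> \<omega>" sequentially \<delta> 0] by simp
    qed simp
    then show ?thesis
      using \<tau>_bd[OF \<omega>] \<delta> by (intro continuous_on_tendsto_compose[OF continuous_on_payoff[OF \<omega>]])
        (auto simp: less_imp_le)
  qed
  show meas_\<tau>: "random_variable borel (\<lambda>\<omega>. payoff x (\<tau> \<omega>) \<omega>)"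
    by (rule borel_measurable_LIMSEQ_real[OF lim meas])
  have "(\<lambda>N. expectation (\<lambda>\<omega>. payoff x (\<kappa> N \<omega> * \<delta> N) \<omega>)) \<longlonglongrightarrow> expectation (\<lambda>\<omega>. payoff x (\<tau> \<omega>) \<omega>)"
    using lim payoff_le[OF x] payoff_nonneg \<delta>
    by (intro integral_dominated_convergence[where w = "\<lambda>_. K"] meas_\<tau> meas) (auto simp: less_imp_le)
  moreover have le: "expectation (\<lambda>\<omega>. payoff x (\<kappa> N \<omega> * \<delta> N) \<omega>) \<le> berm (\<delta> N) (Suc N) x" for N
  proof (rule grid_payoff_le_berm[OF _ x \<kappa>_F])
    fix \<omega> assume "\<omega> \<in> space M"
    then show "\<kappa> N \<omega> \<le> Suc N"
      using \<tau>_bd[of \<omega>] by (simp add: \<kappa>_le \<delta>_def)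
  qed (use \<delta>[of N] in simp)
  assume "e > 0"
  ultimately have "\<forall>\<^sub>F N in sequentially. expectation (\<lambda>\<omega>. payoff x (\<tau> \<omega>) \<omega>) - e < expectation (\<lambda>\<omega>. payoff x (\<kappa> N \<omega> * \<delta> N) \<omega>)"
    by (intro order_tendstoD(1)) auto
  then have "\<forall>\<^sub>F N in sequentially. expectation (\<lambda>\<omega>. payoff x (\<tau> \<omega>) \<omega>) - e < berm (u / Suc N) (Suc N) x"
    by eventually_elim (use le in \<open>auto simp: \<delta>_def simp del: berm.simps of_nat_Suc intro: less_le_trans\<close>)
  then show "\<forall>\<^sub>F N in sequentially. expectation (\<lambda>\<omega>. payoff x (\<tau> \<omega>) \<omega>) - e < berm (u / N) N x"
    by (subst (asm) eventually_sequentially_Suc[of "\<lambda>N. expectation (\<lambda>\<omega>. payoff x (\<tau> \<omega>) \<omega>) - e < berm (u / N) N x"])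
qed

lemma zero_stopping_time: "0 \<le> u \<Longrightarrow> (\<lambda>_. 0) \<in> stopping_times_upto M Z u"
  by (simp add: stopping_times_upto_def stopping_time_const)

lemma expectation_payoff_le:
  assumes "\<tau> \<in> stopping_times_upto M (X x) u" "0 < u" "0 < x"
  shows "expectation (\<lambda>\<omega>. payoff x (\<tau> \<omega>) \<omega>) \<le> K"
proof -
  have bd: "norm (payoff x (\<tau> \<omega>) \<omega>) \<le> K" if "\<omega> \<in> space M" for \<omega>
    using payoff_le payoff_nonneg stopping_times_upto_bounds[OF assms(1) that] assms(3) by auto
  have "expectation (\<lambda>\<omega>. payoff x (\<tau> \<omega>) \<omega>) \<le> expectation (\<lambda>_. K)"
    using bd K_pos
    by (intro integral_mono integrable_const_bound[of _ K] borel_measurable_payoff_stopping[OF assms])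
       (auto simp: abs_le_iff)
  then show ?thesis by (simp add: prob_space)
qed

lemma bdd_above_payoff:
  assumes "0 < u" "0 < x"
  shows "bdd_above ((\<lambda>\<tau>. expectation (\<lambda>\<omega>. payoff x (\<tau> \<omega>) \<omega>)) ` stopping_times_upto M (X x) u)"
  using expectation_payoff_le assms by (intro bdd_aboveI2[of _ _ K]) auto

lemma val_mono:
  assumes "0 \<le> u" "u \<le> u'" "0 < u'" "0 < x"
  shows "val u x \<le> val u' x"
  unfolding val_def
proof (rule cSUP_subset_mono)
  show "stopping_times_upto M (X x) u \<noteq> {}" using zero_stopping_time[OF assms(1)] by auto
  show "stopping_times_upto M (X x) u \<subseteq> stopping_times_upto M (X x) u'"
    using assms by (auto simp: stopping_times_upto_def intro: order_trans)
qed (use assms bdd_above_payoff in auto)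

text \<open>Serves to show that the continuation set contains no point with t = T, so that its
  points have a positive time to maturity.\<close>

lemma val_0: "val 0 x = G x"
proof -
  have "expectation (\<lambda>\<omega>. payoff x (\<tau> \<omega>) \<omega>) = G x" if "\<tau> \<in> stopping_times_upto M (X x) 0" for \<tau>
  proof -
    have "payoff x (\<tau> \<omega>) \<omega> = G x" if "\<omega> \<in> space M" for \<omega>
    proof -
      have "\<tau> \<omega> = 0" using stopping_times_upto_bounds[OF \<open>\<tau> \<in> _\<close> that] by simp
      then show ?thesis using start_zero[OF that] by (simp add: payoff_def gbm_def)
    qed
    then have "expectation (\<lambda>\<omega>. payoff x (\<tau> \<omega>) \<omega>) = expectation (\<lambda>_. G x)"
      by (intro Bochner_Integration.integral_cong) auto
    then show ?thesis by (simp add: prob_space)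
  qed
  then have "(\<lambda>\<tau>. expectation (\<lambda>\<omega>. payoff x (\<tau> \<omega>) \<omega>)) ` stopping_times_upto M (X x) 0 = {G x}"
    using zero_stopping_time[of 0 "X x"] by (auto simp: image_iff intro!: bexI[of _ "\<lambda>_. 0"])
  then show ?thesis by (simp add: val_def)
qed

lemma berm_le_val:
  assumes u: "0 < u" and x: "0 < x" and N: "0 < N"
  shows "berm (u / N) N x \<le> val u x"
proof -
  define \<delta> where "\<delta> = u / N"
  have \<delta>: "0 < \<delta>" using u N by (simp add: \<delta>_def)
  obtain \<kappa> :: "'a \<Rightarrow> nat" where \<kappa>: "\<And>\<omega>. \<kappa> \<omega> \<le> N"
    "\<And>k. {\<omega> \<in> space M. \<kappa> \<omega> \<le> k} \<in> sets (natural_filtration M (X x) (k * \<delta>))"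
    "\<And>A. A \<in> sets (natural_filtration M (X x) 0) \<Longrightarrow>
      expectation (\<lambda>\<omega>. indicator A \<omega> * berm \<delta> N (X x 0 \<omega>))
      \<le> expectation (\<lambda>\<omega>. indicator A \<omega> * payoff x (\<kappa> \<omega> * \<delta>) \<omega>)"
    using grid_optimal_stopping[of \<delta> x N N] \<delta> x by auto
  have "berm \<delta> N x = expectation (\<lambda>\<omega>. indicator (space M) \<omega> * berm \<delta> N (X x 0 \<omega>))"
  proof -
    have "expectation (\<lambda>\<omega>. indicator (space M) \<omega> * berm \<delta> N (X x 0 \<omega>)) = expectation (\<lambda>_. berm \<delta> N x)"
      using start_zero by (intro Bochner_Integration.integral_cong) (auto simp: gbm_def)
    then show ?thesis by (simp add: prob_space)
  qed
  also have "\<dots> \<le> expectation (\<lambda>\<omega>. indicator (space M) \<omega> * payoff x (\<kappa> \<omega> * \<delta>) \<omega>)"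
    using sets.top[of "natural_filtration M (X x) 0"] by (intro \<kappa>(3)) simp
  also have "\<dots> = expectation (\<lambda>\<omega>. payoff x (\<kappa> \<omega> * \<delta>) \<omega>)"
    by (intro Bochner_Integration.integral_cong) auto
  also have "\<dots> \<le> val u x"
    unfolding val_def
  proof (rule cSUP_upper[OF _ bdd_above_payoff[OF u x]])
    have "{\<omega> \<in> space M. \<kappa> \<omega> * \<delta> \<le> t} \<in> sets (natural_filtration M (X x) t)" for t
    proof (cases "0 \<le> t")
      case True
      \<comment> \<open>Index of the last grid date up to \<open>t\<close>: the event that \<kappa>
        is at most \<open>m\<close> is known at that date, hence at \<open>t\<close>.\<close>
      define m where "m = nat \<lfloor>t / \<delta>\<rfloor>"
      have "\<kappa> \<omega> * \<delta> \<le> t \<longleftrightarrow> \<kappa> \<omega> \<le> m" for \<omega>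
        using \<delta> True by (simp add: m_def le_nat_iff le_floor_iff le_divide_eq)
      moreover have "m * \<delta> \<le> t"
      proof -
        have "real m \<le> t / \<delta>" using \<delta> True by (simp add: m_def)
        then show ?thesis using \<delta> by (simp add: le_divide_eq)
      qed
      ultimately show ?thesis
        using \<kappa>(2)[of m] sets_natural_filtration_mono[of "m * \<delta>" t M "X x"] by auto
    next
      case False
      moreover have "0 \<le> \<kappa> \<omega> * \<delta>" for \<omega> using \<delta> by simp
      ultimately have "{\<omega> \<in> space M. \<kappa> \<omega> * \<delta> \<le> t} = {}" by (auto intro: order_trans)
      then show ?thesis by (simp only: sets.empty_sets)
    qed
    moreover have "\<kappa> \<omega> * \<delta> \<le> u" for \<omega>
    proof -
      have "\<kappa> \<omega> * \<delta> \<le> N * \<delta>" using \<kappa>(1)[of \<omega>] \<delta> by (intro mult_right_mono) auto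
      then show ?thesis using N by (simp add: \<delta>_def)
    qed
    ultimately show "(\<lambda>\<omega>. \<kappa> \<omega> * \<delta>) \<in> stopping_times_upto M (X x) u"
      using \<delta> by (simp add: stopping_times_upto_def stopping_time_def pred_def)
  qed
  finally show ?thesis by (simp add: \<delta>_def)
qed

text \<open>Successive grids are not nested, so convergence comes from the two one-sided bounds and
  not from monotonicity in N.\<close>

lemma berm_tendsto_val:
  assumes u: "0 < u" and x: "0 < x"
  shows "(\<lambda>N. berm (u / N) N x) \<longlonglongrightarrow> val u x"
proof (rule order_tendstoI)
  fix a assume "a < val u x"
  moreover have "stopping_times_upto M (X x) u \<noteq> {}"
    using zero_stopping_time[OF less_imp_le[OF u]] by blast
  ultimately obtain \<tau> where \<tau>: "\<tau> \<in> stopping_times_upto M (X x) u" "a < expectation (\<lambda>\<omega>. payoff x (\<tau> \<omega>) \<omega>)"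
    unfolding val_def using less_cSUP_iff[OF _ bdd_above_payoff[OF u x]] by blast
  from eventually_expectation_payoff_less_berm[OF \<tau>(1) u x, of "expectation (\<lambda>\<omega>. payoff x (\<tau> \<omega>) \<omega>) - a"] \<tau>(2)
  show "\<forall>\<^sub>F N in sequentially. a < berm (u / N) N x" by simp
next
  fix a assume "val u x < a"
  have "\<forall>\<^sub>F N in sequentially. 0 < (N :: nat)" by (rule eventually_gt_at_top)
  then show "\<forall>\<^sub>F N in sequentially. berm (u / N) N x < a"
    by eventually_elim (use berm_le_val[OF u x] \<open>val u x < a\<close> in \<open>auto intro: le_less_trans\<close>)
qed


subsection \<open>Regularity of the value function\<close>

lemma
  assumes u: "0 < u" and x: "0 < x"
  shows val_ge: "G x \<le> val u x" and val_le: "val u x \<le> K"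
proof -
  note lim = berm_tendsto_val[OF u x]
  show "G x \<le> val u x"
    by (rule LIMSEQ_le_const[OF lim]) (use berm_ge in blast)
  show "val u x \<le> K"
    by (rule LIMSEQ_le_const2[OF lim]) (use berm_le[OF _ x] u in auto)
qed

lemma val_lipschitz:
  assumes u: "0 < u" and "0 < x" "0 < y"
  shows "\<bar>val u x - val u y\<bar> \<le> \<bar>x - y\<bar>"
proof -
  have "(\<lambda>N. \<bar>berm (u / N) N x - berm (u / N) N y\<bar>) \<longlonglongrightarrow> \<bar>val u x - val u y\<bar>"
    using assms by (intro tendsto_intros berm_tendsto_val)
  then show ?thesis
    using lipschitz_abs_le[OF berm_lipschitz, of "u / real _" _ x y] u
    by (intro LIMSEQ_le_const2) auto
qed

lemma val_convex:
  assumes u: "0 < u"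
  shows "convex_on {0<..} (val u)"
proof
  fix t x y :: real
  assume t: "0 < t" "t < 1" and xy: "x \<in> {0<..}" "y \<in> {0<..}"
  then have pos: "0 < (1 - t) *\<^sub>R x + t *\<^sub>R y"
    by (simp add: add_pos_pos)
  have "(\<lambda>N. (1 - t) * berm (u / N) N x + t * berm (u / N) N y) \<longlonglongrightarrow> (1 - t) * val u x + t * val u y"
    using xy u by (intro tendsto_intros berm_tendsto_val) auto
  moreover have "berm (u / real N) N ((1 - t) *\<^sub>R x + t *\<^sub>R y) \<le> (1 - t) * berm (u / real N) N x + t * berm (u / real N) N y" for N
    using t u by (intro convex_onD[OF berm_convex]) auto
  ultimately show "val u ((1 - t) *\<^sub>R x + t *\<^sub>R y) \<le> (1 - t) * val u x + t * val u y"
    by (intro LIMSEQ_le[OF berm_tendsto_val[OF u pos]]) auto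
qed simp

section \<open>Dependence on the time to maturity\<close>

lemma berm_subsequence:
  assumes u: "0 < u" and x: "0 < x" and p: "0 < p" and q: "0 < q"
  shows "(\<lambda>k. berm (u / (q * k)) (p * k) x) \<longlonglongrightarrow> val (u * p / q) x"
proof -
  have "(\<lambda>k. berm ((u * p / q) / real (p * k)) (p * k) x) \<longlonglongrightarrow> val (u * p / q) x"
    using assms
    by (intro filterlim_compose[OF berm_tendsto_val mult_nat_left_at_top[OF p]]) auto
  moreover have "(u * p / q) / real (p * k) = u / (q * k)" for k
    using p by simp
  ultimately show ?thesis by simp
qed

text \<open>Horizons in the ratio p / q are both multiples of the mesh u / (q k), so
  \<open>berm_time_le\<close> compares them on one grid, with a bound free of k.\<close>

lemma val_time_le_rational:
  fixes p q :: nat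
  assumes u: "0 < u" and x: "0 < x" and p: "0 < p" "p \<le> q"
  shows "val u x - val (u * p / q) x \<le> x * \<sigma> * (sqrt u - sqrt (u * p / q))"
proof -
  have q: "0 < q" using p by simp
  have "(\<lambda>k. berm (u / (q * k)) (q * k) x - berm (u / (q * k)) (p * k) x) \<longlonglongrightarrow> val u x - val (u * p / q) x"
    using berm_subsequence[OF u x q q] berm_subsequence[OF u x p(1) q] q
    by (intro tendsto_diff) auto
  moreover have "berm (u / (q * k)) (q * k) x - berm (u / (q * k)) (p * k) x \<le> x * \<sigma> * (sqrt u - sqrt (u * p / q))"
    if "0 < k" for k :: nat
  proof -
    have "p * k + (q * k - p * k) = q * k" using p by simp
    then have "berm (u / (q * k)) (q * k) x - berm (u / (q * k)) (p * k) x
        \<le> x * \<sigma> * (sqrt (real (q * k) * (u / (q * k))) - sqrt (real (p * k) * (u / (q * k))))"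
      using berm_time_le[of "u / (q * k)" x "p * k" "q * k - p * k"] u x
      by (simp only: of_nat_add[symmetric]) simp
    also have "real (q * k) * (u / (q * k)) = u" using q that by simp
    also have "real (p * k) * (u / (q * k)) = u * p / q" using q that by simp
    finally show ?thesis .
  qed
  ultimately show ?thesis
    by (intro LIMSEQ_le_const2) (auto intro!: exI[of _ 1])
qed

text \<open>The ratio is approximated by rationals from below. Monotonicity in the horizon then
  replaces continuity in time, which is only a consequence of this estimate.\<close>

lemma val_time_le:
  assumes u: "0 < u'" "u' \<le> u" and x: "0 < x"
  shows "val u x - val u' x \<le> x * \<sigma> * (sqrt u - sqrt u')"
proof -
  define p where "p n = nat \<lfloor>n * (u' / u)\<rfloor>" for n :: nat
  have "0 < u" using u by simp
  have p_le: "p n \<le> n * (u' / u)" for n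
    using u unfolding p_def by simp
  have lim: "(\<lambda>n. p n / n) \<longlonglongrightarrow> u' / u"
  proof (rule tendsto_sandwich[of "\<lambda>n. u' / u - 1 / real n" _ _ "\<lambda>_. u' / u"])
    show "\<forall>\<^sub>F n in sequentially. u' / u - 1 / n \<le> p n / n"
      using eventually_gt_at_top[of 0]
    proof eventually_elim
      case (elim n)
      have "n * (u' / u) - 1 \<le> p n" using u unfolding p_def by linarith
      then have "(n * (u' / u) - 1) / n \<le> p n / n" by (rule divide_right_mono) simp
      with elim show ?case by (simp add: diff_divide_distrib)
    qed
    show "\<forall>\<^sub>F n in sequentially. p n / n \<le> u' / u"
      using eventually_gt_at_top[of 0]
    proof eventually_elim
      case (elim n)
      with p_le[of n] show ?case by (simp add: field_simps)
    qed
    show "(\<lambda>n. u' / u - 1 / real n) \<longlonglongrightarrow> u' / u"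
      using tendsto_diff[OF tendsto_const lim_const_over_n[of 1]] by simp
  qed simp
  have "(\<lambda>n. x * \<sigma> * (sqrt u - sqrt (u * (p n / n)))) \<longlonglongrightarrow> x * \<sigma> * (sqrt u - sqrt (u * (u' / u)))"
    by (intro tendsto_intros lim)
  then have "(\<lambda>n. x * \<sigma> * (sqrt u - sqrt (u * (p n / n)))) \<longlonglongrightarrow> x * \<sigma> * (sqrt u - sqrt u')"
    using \<open>0 < u\<close> by simp
  moreover have "\<forall>\<^sub>F n in sequentially. val u x - val u' x \<le> x * \<sigma> * (sqrt u - sqrt (u * (p n / n)))"
    using order_tendstoD(1)[OF lim divide_pos_pos[OF u(1) \<open>0 < u\<close>]] eventually_gt_at_top[of 0]
  proof eventually_elim
    case (elim n)
    then have "0 < p n" using u by (simp add: zero_less_divide_iff)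
    have "real (p n) \<le> real n"
      using p_le[of n] u \<open>0 < u\<close> mult_left_mono[of "u' / u" 1 "real n"] by simp
    have "u * (p n / n) \<le> u'"
      using p_le[of n] \<open>0 < u\<close> elim by (simp add: field_simps)
    then have "val (u * p n / n) x \<le> val u' x"
      using \<open>0 < u\<close> \<open>0 < p n\<close> u x by (intro val_mono) auto
    then show ?case
      using val_time_le_rational[OF \<open>0 < u\<close> x \<open>0 < p n\<close>, of n] \<open>real (p n) \<le> real n\<close> by simp
  qed
  ultimately show ?thesis
    by (intro tendsto_lowerbound) auto
qed

section \<open>Supermartingale estimates\<close>

lemma borel_measurable_val_growth:
  assumes "0 < u" "0 < x"
  shows "(\<lambda>z. val u (x * growth s z)) \<in> borel_measurable gauss"
proof (rule borel_measurable_LIMSEQ_real)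
  show "(\<lambda>N. berm (u / N) N (x * growth s z)) \<longlonglongrightarrow> val u (x * growth s z)" for z
    using assms growth_pos by (intro berm_tendsto_val) auto
  have "berm (u / real N) N \<in> borel_measurable borel" for N
    using assms by (intro lipschitz_borel_measurable[OF berm_lipschitz]) auto
  then show "(\<lambda>z. berm (u / real N) N (x * growth s z)) \<in> borel_measurable gauss" for N
    by measurable
qed

lemma val_abs_le: "0 < u \<Longrightarrow> 0 < x \<Longrightarrow> \<bar>val u x\<bar> \<le> K"
  using val_ge[of u x] val_le[of u x] put_gain_nonneg[of x] by (simp add: abs_le_iff)

text \<open>\<open>val_lipschitz\<close> speaks of positive prices only, so
  \<open>integrable_lipschitz_growth\<close> does not apply; the bound by \<open>K\<close> takes its
  place.\<close>

lemma integrable_val_growth: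
  assumes "0 < u" "0 < x"
  shows "integrable gauss (\<lambda>z. val u (x * growth s z))"
  using val_abs_le[OF assms(1)] assms growth_pos
  by (intro gauss.integrable_const_bound[of _ K] borel_measurable_val_growth) auto

text \<open>With s = u / l both u and u - s lie on the grids of mesh u / (l k), where
  \<open>Q_berm_le\<close> with \<open>k\<close> waiting steps applies; dominated convergence passes
  to the limit in k.\<close>

lemma val_supermartingale:
  fixes l :: nat
  assumes u: "0 < u" and x: "0 < x" and l: "2 \<le> l"
  shows "Q (u / l) (val (u - u / l)) x \<le> val u x"
proof -
  define u' where "u' = u * real (l - 1) / l"
  have u': "u' = u - u / l" "0 < u'" using l u by (auto simp: u'_def of_nat_diff field_simps)
  define w where "w k = berm (u / (l * k)) ((l - 1) * k)" for k
  have w: "(\<lambda>k. w k y) \<longlonglongrightarrow> val u' y" if "0 < y" for y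
    unfolding w_def u'_def using l u that by (intro berm_subsequence) auto
  have "(\<lambda>k. \<integral>z. w k (x * growth (u / l) z) \<partial>gauss) \<longlonglongrightarrow> (\<integral>z. val u' (x * growth (u / l) z) \<partial>gauss)"
  proof (rule integral_dominated_convergence[where w = "\<lambda>_. K"])
    have "w k \<in> borel_measurable borel" for k
      unfolding w_def using u by (intro lipschitz_borel_measurable[OF berm_lipschitz]) auto
    then show "(\<lambda>z. w k (x * growth (u / l) z)) \<in> borel_measurable gauss" for k
      by measurable
    show "AE z in gauss. norm (w k (x * growth (u / l) z)) \<le> K" for k
    proof (rule AE_I2)
      fix z
      have "0 < x * growth (u / l) z" using x growth_pos by simp
      then show "norm (w k (x * growth (u / l) z)) \<le> K"
        unfolding w_def using berm_le berm_ge order_trans[OF put_gain_nonneg berm_ge] u by simp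
    qed
  qed (use w x growth_pos u'(2) in \<open>auto intro!: borel_measurable_val_growth\<close>)
  then have "(\<lambda>k. Q (u / l) (w k) x) \<longlonglongrightarrow> Q (u / l) (val u') x"
    unfolding Q_def P_def by (intro tendsto_intros)
  moreover have "(\<lambda>k. berm (u / (l * k)) (l * k) x) \<longlonglongrightarrow> val u x"
    using berm_subsequence[OF u x, of l l] l by simp
  moreover have "Q (u / l) (w k) x \<le> berm (u / (l * k)) (l * k) x" if "0 < k" for k
  proof -
    have "real k * (u / (l * k)) = u / l" "(l - 1) * k + k = l * k"
      using that l by (auto simp: algebra_simps)
    then show ?thesis
      using Q_berm_le[of "u / (l * k)" x k "(l - 1) * k"] u x by (simp add: w_def)
  qed
  ultimately show ?thesis
    unfolding u'(1)[symmetric] by (intro LIMSEQ_le) (auto intro!: exI[of _ 1])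
qed

text \<open>Keeping the horizon at u although time has passed costs the bound of
  \<open>val_time_le\<close> at the price reached. That bound is linear in the price and the
  discounted price has mean \<open>x\<close>, so the cost reappears evaluated at
  \<open>x\<close>.\<close>

lemma val_almost_supermartingale:
  fixes l :: nat
  assumes u: "0 < u" and x: "0 < x" and l: "2 \<le> l"
  shows "Q (u / l) (val u) x \<le> val u x + x * \<sigma> * (sqrt u - sqrt (u - u / l))"
proof -
  define s where "s = u / l"
  have s: "0 < s" "s < u" using u l by (auto simp: s_def field_simps)
  let ?c = "\<sigma> * (sqrt u - sqrt (u - s))"
  have "P s (val u) x \<le> (\<integral>z. val (u - s) (x * growth s z) + ?c * x * growth s z \<partial>gauss)"
    unfolding P_def
  proof (rule integral_mono)
    fix z
    show "val u (x * growth s z) \<le> val (u - s) (x * growth s z) + ?c * x * growth s z"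
      using val_time_le[of "u - s" u "x * growth s z"] s x growth_pos[of s z] by (simp add: mult_ac)
  qed (use s u x integrable_growth[of s] in \<open>auto intro!: integrable_val_growth\<close>)
  also have "\<dots> = P s (val (u - s)) x + ?c * x * exp (r * s)"
    using s u x integrable_growth[of s] integrable_val_growth[of "u - s" x s] by (simp add: P_def integral_growth)
  finally have "exp (- r * s) * P s (val u) x \<le> exp (- r * s) * (P s (val (u - s)) x + ?c * x * exp (r * s))"
    by (intro mult_left_mono) auto
  also have "\<dots> = Q s (val (u - s)) x + x * ?c"
    by (simp add: Q_def distrib_left exp_minus field_simps)
  also have "\<dots> \<le> val u x + x * ?c"
    using val_supermartingale[OF u x l] by (simp add: s_def)
  finally show ?thesis by (simp add: Q_def s_def mult_ac)
qed

section \<open>Absence of kinks\<close>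

lemma growth_deviation:
  assumes s: "0 < s"
  shows "measure gauss {1..2} * (exp (\<sigma> * sqrt s + (r - \<sigma>\<^sup>2 / 2) * s) - 1) \<le> (\<integral>z. \<bar>growth s z - 1\<bar> \<partial>gauss)"
proof -
  \<comment> \<open>Only outcomes between 1 and 2 are kept. There \<open>growth\<close> is at least
    its value at z = 1, which exceeds 1 by order sqrt s. Another interval of positive z would change
    only the constant.\<close>
  have "(\<integral>z. indicator {1..2} z * (exp (\<sigma> * sqrt s + (r - \<sigma>\<^sup>2 / 2) * s) - 1) \<partial>gauss) \<le> (\<integral>z. \<bar>growth s z - 1\<bar> \<partial>gauss)"
  proof (rule integral_mono)
    fix z :: real
    show "indicator {1..2} z * (exp (\<sigma> * sqrt s + (r - \<sigma>\<^sup>2 / 2) * s) - 1) \<le> \<bar>growth s z - 1\<bar>"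
    proof (cases "z \<in> {1..2}")
      case True
      then have "\<sigma> * sqrt s * 1 \<le> \<sigma> * sqrt s * z"
        using s \<sigma>_pos by (intro mult_left_mono) auto
      then have "exp (\<sigma> * sqrt s + (r - \<sigma>\<^sup>2 / 2) * s) \<le> growth s z"
        by (simp add: growth_def mult.assoc)
      with True show ?thesis by simp
    qed simp
  qed (use s integrable_growth[of s] in \<open>auto intro!: integrable_gauss_indicator\<close>)
  then show ?thesis by simp
qed

lemma val_differentiable:
  assumes u: "0 < u" and x: "0 < x"
  shows "val u differentiable at x"
proof (rule convex_differentiable_or_kink[OF val_convex[OF u] x])
  fix m c :: real
  assume c: "0 < c" and kink: "\<And>y. 0 < y \<Longrightarrow> val u x + m * (y - x) + c * \<bar>y - x\<bar> \<le> val u y"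
  define q where "q = measure gauss {1..2}"
  have "0 < q" unfolding q_def by (rule gauss_interval_pos) simp
  define f where "f = val u x"
  \<comment> \<open>The gap between the upper bound for \<open>Q s (val u) x\<close> and the lower
    bound that the kink imposes, on the scale sqrt s.\<close>
  define \<phi> where "\<phi> s = (f + x * \<sigma> * (sqrt u - sqrt (u - s)) -
    exp (- r * s) * (f + m * x * (exp (r * s) - 1) + c * x * q * (exp (\<sigma> * sqrt s + (r - \<sigma>\<^sup>2 / 2) * s) - 1))) / sqrt s" for s
  have nonneg: "0 \<le> \<phi> (u / l)" if l: "2 \<le> l" for l :: nat
  proof -
    define s where "s = u / l"
    have s: "0 < s" using u l by (simp add: s_def)
    have "f + m * x * (exp (r * s) - 1) + c * x * (\<integral>z. \<bar>growth s z - 1\<bar> \<partial>gauss)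
      = (\<integral>z. f + m * x * (growth s z - 1) + c * x * \<bar>growth s z - 1\<bar> \<partial>gauss)"
      using integrable_growth[of s] s by (simp add: integral_growth gauss.prob_space[simplified])
    also have "\<dots> \<le> P s (val u) x"
      unfolding P_def
    proof (rule integral_mono)
      fix z
      have "\<bar>x * growth s z - x\<bar> = x * \<bar>growth s z - 1\<bar>"
        using x abs_mult[of x "growth s z - 1"] by (simp add: right_diff_distrib)
      then show "f + m * x * (growth s z - 1) + c * x * \<bar>growth s z - 1\<bar> \<le> val u (x * growth s z)"
        using kink[of "x * growth s z"] x growth_pos[of s z] by (simp add: f_def algebra_simps)
    qed (use s u x integrable_growth[of s] in \<open>auto intro!: integrable_val_growth\<close>)
    finally have 1: "f + m * x * (exp (r * s) - 1) + c * x * (\<integral>z. \<bar>growth s z - 1\<bar> \<partial>gauss) \<le> P s (val u) x" .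
    have "c * x * (q * (exp (\<sigma> * sqrt s + (r - \<sigma>\<^sup>2 / 2) * s) - 1)) \<le> c * x * (\<integral>z. \<bar>growth s z - 1\<bar> \<partial>gauss)"
      using growth_deviation[OF s] c x by (intro mult_left_mono) (auto simp: q_def)
    with 1 have "exp (- r * s) * (f + m * x * (exp (r * s) - 1) + c * x * q * (exp (\<sigma> * sqrt s + (r - \<sigma>\<^sup>2 / 2) * s) - 1))
      \<le> exp (- r * s) * P s (val u) x"
      by (intro mult_left_mono) (auto simp: mult.assoc)
    also have "\<dots> \<le> f + x * \<sigma> * (sqrt u - sqrt (u - s))"
      using val_almost_supermartingale[OF u x l] by (simp add: Q_def f_def s_def)
    finally show ?thesis
      using s unfolding \<phi>_def s_def[symmetric] by simp
  qed
  \<comment> \<open>\<phi> regrouped as in \<open>eq\<close> below. The time cost and the discount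
    and drift terms vanish on the scale sqrt s; the kink term survives, with \<sigma> coming from
    the first-order expansion of the exponential.\<close>
  have lim: "((\<lambda>s. x * \<sigma> * ((sqrt u - sqrt (u - s)) / sqrt s) + (f - m * x) * ((1 - exp (- r * s)) / sqrt s) -
      c * x * q * (exp (- r * s) * (exp (\<sigma> * sqrt s + (r - \<sigma>\<^sup>2 / 2) * s) - 1) / sqrt s)) \<longlongrightarrow>
      x * \<sigma> * 0 + (f - m * x) * 0 - c * x * q * \<sigma>) (at_right 0)"
  proof (intro tendsto_intros)
    show "((\<lambda>s. (sqrt u - sqrt (u - s)) / sqrt s) \<longlongrightarrow> 0) (at_right 0)"
    proof (rule tendsto_sandwich[of "\<lambda>_. 0" _ _ "\<lambda>s. sqrt s / sqrt u"])
      \<comment> \<open>Multiplying the numerator by sqrt u bounds it by s. This is the place where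
        a positive horizon is decisive.\<close>
      have le: "0 \<le> (sqrt u - sqrt (u - s)) / sqrt s \<and> (sqrt u - sqrt (u - s)) / sqrt s \<le> sqrt s / sqrt u"
        if s: "s \<in> {0<..<u}" for s
      proof -
        have "sqrt (u - s) * sqrt (u - s) \<le> sqrt (u - s) * sqrt u"
          using s by (intro mult_left_mono) auto
        then have "(sqrt u - sqrt (u - s)) * sqrt u \<le> sqrt s * sqrt s"
          using s u by (simp add: left_diff_distrib)
        then show ?thesis using s u by (simp add: field_simps)
      qed
      have ev: "\<forall>\<^sub>F s in at_right 0. s \<in> {0<..<u}"
        by (rule eventually_at_right_real[OF u])
      show "\<forall>\<^sub>F s in at_right 0. 0 \<le> (sqrt u - sqrt (u - s)) / sqrt s"
        "\<forall>\<^sub>F s in at_right 0. (sqrt u - sqrt (u - s)) / sqrt s \<le> sqrt s / sqrt u"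
        using ev by (eventually_elim, use le in blast)+
      show "((\<lambda>s. sqrt s / sqrt u) \<longlongrightarrow> 0) (at_right 0)"
        using u by (auto intro!: tendsto_eq_intros)
    qed simp
    show "((\<lambda>s. (1 - exp (- r * s)) / sqrt s) \<longlongrightarrow> 0) (at_right 0)"
      using r_pos by real_asymp
    show "((\<lambda>s. exp (- r * s) * (exp (\<sigma> * sqrt s + (r - \<sigma>\<^sup>2 / 2) * s) - 1) / sqrt s) \<longlongrightarrow> \<sigma>) (at_right 0)"
      using r_pos \<sigma>_pos by real_asymp
  qed
  have eq: "\<phi> s = x * \<sigma> * ((sqrt u - sqrt (u - s)) / sqrt s) + (f - m * x) * ((1 - exp (- r * s)) / sqrt s) -
      c * x * q * (exp (- r * s) * (exp (\<sigma> * sqrt s + (r - \<sigma>\<^sup>2 / 2) * s) - 1) / sqrt s)" for s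
  proof -
    have e: "exp (- r * s) * (m * x * (exp (r * s) - 1)) = m * x * (1 - exp (- r * s))"
      by (simp add: algebra_simps exp_minus)
    show ?thesis
      unfolding \<phi>_def distrib_left e by (simp add: add_divide_distrib diff_divide_distrib algebra_simps)
  qed
  have "(\<phi> \<longlongrightarrow> - (c * x * q * \<sigma>)) (at_right 0)"
    using lim[folded eq] by simp
  \<comment> \<open>\<open>nonneg\<close> is available only for s = u / l, so the limit is taken
    along this sequence.\<close>
  moreover have "filterlim (\<lambda>l. u / real l) (at_right 0) sequentially"
    using u by real_asymp
  ultimately have "(\<lambda>l. \<phi> (u / real l)) \<longlonglongrightarrow> - (c * x * q * \<sigma>)"
    by (rule filterlim_compose)
  then have "0 \<le> - (c * x * q * \<sigma>)"
    by (rule LIMSEQ_le_const) (use nonneg in auto)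
  moreover have "0 < c * x * q * \<sigma>"
    using c x \<open>0 < q\<close> \<sigma>_pos by simp
  ultimately show ?thesis by simp
qed

text \<open>Waiting until maturity already has positive value, since the terminal price falls below
  \<open>K / 2\<close> with positive probability. As \<open>G\<close> vanishes from \<open>K\<close>
  on, stopping points must lie below the strike.\<close>

lemma val_pos:
  assumes u: "0 < u" and x: "0 < x"
  shows "0 < val u x"
proof -
  \<comment> \<open>Solves \<open>x * growth u d = K / 2\<close>.\<close>
  define d where "d = (ln (K / (2 * x)) - (r - \<sigma>\<^sup>2 / 2) * u) / (\<sigma> * sqrt u)"
  have le: "x * growth u z \<le> K / 2" if "z \<le> d" for z
  proof -
    have "(\<sigma> * sqrt u) * z \<le> (\<sigma> * sqrt u) * d"
      using that \<sigma>_pos u by (intro mult_left_mono) auto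
    also have "\<dots> = ln (K / (2 * x)) - (r - \<sigma>\<^sup>2 / 2) * u"
      using \<sigma>_pos u by (simp add: d_def)
    finally have "growth u z \<le> exp (ln (K / (2 * x)))"
      by (simp add: growth_def mult.assoc)
    then show ?thesis using x K_pos by (simp add: field_simps)
  qed
  have "0 < K / 2 * measure gauss {d - 1..d}"
    using K_pos by (intro mult_pos_pos gauss_interval_pos) auto
  also have "\<dots> = (\<integral>z. K / 2 * indicator {d - 1..d} z \<partial>gauss)"
    by simp
  also have "\<dots> \<le> P u G x"
    unfolding P_def
  proof (rule integral_mono)
    fix z
    show "K / 2 * indicator {d - 1..d} z \<le> G (x * growth u z)"
    proof (cases "z \<in> {d - 1..d}")
      case True
      with le[of z] K_pos show ?thesis by (simp add: put_gain_def)
    qed (simp add: put_gain_nonneg)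
  qed (use u in \<open>auto intro!: integrable_lipschitz_growth put_gain_lipschitz integrable_mult_right integrable_gauss_indicator simp del: times_divide_eq_left\<close>)
  finally have "0 < Q u G x" by (simp add: Q_def)
  also have "\<dots> \<le> berm (u / real 1) 1 x" by simp
  also have "\<dots> \<le> val u x" by (rule berm_le_val[OF u x]) simp
  finally show ?thesis .
qed

lemma val_time_abs_le:
  assumes "0 < u" "0 < u'" "0 < x"
  shows "\<bar>val u x - val u' x\<bar> \<le> x * \<sigma> * \<bar>sqrt u - sqrt u'\<bar>"
proof (cases "u \<le> u'")
  case True
  then show ?thesis using val_time_le[of u u' x] val_mono[of u u' x] assms by (simp add: abs_if)
next
  case False
  then show ?thesis using val_time_le[of u' u x] val_mono[of u' u x] assms by (simp add: abs_if)
qed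

lemma tendsto_val:
  assumes un: "un \<longlonglongrightarrow> u" and xn: "xn \<longlonglongrightarrow> x" and u: "0 < u" and x: "0 < x"
  shows "(\<lambda>n. val (un n) (xn n)) \<longlonglongrightarrow> val u x"
proof -
  have "(\<lambda>n. xn n * \<sigma> * \<bar>sqrt (un n) - sqrt u\<bar> + \<bar>xn n - x\<bar>) \<longlonglongrightarrow> x * \<sigma> * \<bar>sqrt u - sqrt u\<bar> + \<bar>x - x\<bar>"
    by (intro tendsto_intros un xn)
  then have lim: "(\<lambda>n. xn n * \<sigma> * \<bar>sqrt (un n) - sqrt u\<bar> + \<bar>xn n - x\<bar>) \<longlonglongrightarrow> 0" by simp
  have "\<forall>\<^sub>F n in sequentially. norm (val (un n) (xn n) - val u x) \<le> xn n * \<sigma> * \<bar>sqrt (un n) - sqrt u\<bar> + \<bar>xn n - x\<bar>"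
    using order_tendstoD(1)[OF un u] order_tendstoD(1)[OF xn x]
  proof eventually_elim
    case (elim n)
    then show ?case
      using val_time_abs_le[of "un n" u "xn n"] val_lipschitz[OF u, of "xn n" x] u x by simp
  qed
  from Lim_null_comparison[OF this lim] show ?thesis by (rule LIM_zero_cancel)
qed

subsection \<open>Smooth fit\<close>

text \<open>Below the strike \<open>G\<close> has slope -1, and the 1-Lipschitz value cannot rise
  faster than that to the left. Contact at \<open>b\<close> therefore persists at all smaller
  prices.\<close>

lemma val_eq_put_gain_left:
  assumes u: "0 < u" and eq: "val u b = G b" and b: "b \<le> K" and x: "0 < x" "x \<le> b"
  shows "val u x = G x"
proof -
  have "val u x \<le> val u b + (b - x)"
    using val_lipschitz[OF u x(1), of b] x by simp
  also have "\<dots> = G x" using eq b x by (simp add: put_gain_def)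
  finally show ?thesis using val_ge[OF u x(1)] by simp
qed

lemma stopping_point_less_strike:
  assumes u: "0 < u" and b: "0 < b" and eq: "val u b = G b"
  shows "b < K"
  using val_pos[OF u b] eq by (simp add: put_gain_def max_def split: if_splits)

lemma smooth_fit:
  assumes u: "0 < u" and b: "0 < b" and eq: "val u b = G b"
  shows "(val u has_real_derivative -1) (at b)"
proof -
  have bK: "b < K" by (rule stopping_point_less_strike[OF assms])
  obtain D where D: "(val u has_real_derivative D) (at b)"
    using val_differentiable[OF u b] real_differentiable_def by blast
  then have "((\<lambda>y. (val u y - val u b) / (y - b)) \<longlongrightarrow> D) (at_left b)"
    unfolding has_field_derivative_iff by (rule filterlim_mono) (auto simp: at_le)
  moreover have "\<forall>\<^sub>F y in at_left b. (val u y - val u b) / (y - b) = -1"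
    using eventually_at_left_real[OF b]
  proof eventually_elim
    case (elim y)
    then have "val u y = K - y" "val u b = K - b"
      using val_eq_put_gain_left[OF u eq _ _, of y] eq bK by (auto simp: put_gain_def)
    moreover have "y - b \<noteq> 0" using elim by simp
    ultimately show ?case by (simp add: divide_eq_eq)
  qed
  then have "((\<lambda>y. (val u y - val u b) / (y - b)) \<longlongrightarrow> -1) (at_left b)"
    by (rule tendsto_eventually)
  ultimately have "D = -1" by (intro tendsto_unique[of "at_left b"]) auto
  with D show ?thesis by simp
qed

text \<open>The tangent at \<open>x\<close> lies below the convex function: at \<open>x + h\<close>
  this gives the upper bound, at \<open>x / 2\<close>, with the Lipschitz bound, the lower
  one.\<close>

lemma deriv_val_bounds:
  assumes u: "0 < u" and x: "0 < x" and h: "0 < h"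
  shows "-1 \<le> deriv (val u) x" "deriv (val u) x \<le> (val u (x + h) - val u x) / h"
proof -
  have D: "(val u has_real_derivative deriv (val u) x) (at x)"
    using val_differentiable[OF u x] by (simp add: DERIV_deriv_iff_real_differentiable)
  have tangent: "deriv (val u) x * (y - x) \<le> val u y - val u x" if "0 < y" for y
    using x that
    by (intro convex_on_imp_above_tangent[OF val_convex[OF u]] has_field_derivative_at_within[OF D])
       (auto simp: interior_open)
  have "\<bar>x / 2 - x\<bar> = x / 2" using x by simp
  then have "deriv (val u) x * (x / 2 - x) \<le> x / 2"
    using tangent[of "x / 2"] val_lipschitz[OF u, of "x / 2" x] x by linarith
  then have "0 \<le> (deriv (val u) x + 1) * (x / 2)" by (simp add: algebra_simps)
  then show "-1 \<le> deriv (val u) x" using x by (simp add: zero_le_mult_iff)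
  show "deriv (val u) x \<le> (val u (x + h) - val u x) / h"
    using tangent[of "x + h"] x h by (simp add: pos_le_divide_eq)
qed

text \<open>Smooth fit supplies an \<open>h\<close> whose difference quotient at \<open>b\<close> is
  below a given a > -1. With \<open>h\<close> fixed the quotient is continuous in horizon and price,
  so nearby quotients, and by convexity the derivatives, stay below a.\<close>

lemma deriv_val_tendsto:
  assumes un: "un \<longlonglongrightarrow> u" and xn: "xn \<longlonglongrightarrow> b" and u: "0 < u" and b: "0 < b" and eq: "val u b = G b"
  shows "(\<lambda>n. deriv (val (un n)) (xn n)) \<longlonglongrightarrow> -1"
proof (rule order_tendstoI)
  note ev = order_tendstoD(1)[OF un u] order_tendstoD(1)[OF xn b]
  fix a :: real
  {
    assume "a < -1"
    from ev show "\<forall>\<^sub>F n in sequentially. a < deriv (val (un n)) (xn n)"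
      by eventually_elim (use deriv_val_bounds(1)[of _ _ 1] \<open>a < -1\<close> in \<open>auto intro: less_le_trans\<close>)
  }
  {
    assume "-1 < a"
    have "((\<lambda>h. (val u (b + h) - val u b) / h) \<longlongrightarrow> -1) (at_right 0)"
      using smooth_fit[OF u b eq] unfolding DERIV_def by (rule filterlim_mono) (auto simp: at_le)
    then have "\<forall>\<^sub>F h in at_right 0. (val u (b + h) - val u b) / h < a \<and> 0 < h"
      using order_tendstoD(2)[OF _ \<open>-1 < a\<close>] eventually_at_right_less by (intro eventually_conj)
    then obtain h where h: "(val u (b + h) - val u b) / h < a" "0 < h"
      using eventually_happens'[of "at_right (0::real)"] by fastforce
    have "(\<lambda>n. (val (un n) (xn n + h) - val (un n) (xn n)) / h) \<longlonglongrightarrow> (val u (b + h) - val u b) / h"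
      using u b h by (intro tendsto_intros tendsto_val un xn) auto
    from order_tendstoD(2)[OF this h(1)] ev
    show "\<forall>\<^sub>F n in sequentially. deriv (val (un n)) (xn n) < a"
      by eventually_elim (use deriv_val_bounds(2)[OF _ _ h(2)] in \<open>auto intro: le_less_trans\<close>)
  }
qed

section \<open>Passage to the definitions of the statement\<close>

lemma put_value_eq: "put_value M B r \<sigma> K T t = val (T - t)"
  by (rule ext) (simp add: put_value_def val_def payoff_def)

lemma continuation_setD:
  assumes "(t, x) \<in> continuation_set M B r \<sigma> K T"
  shows "0 < T - t" "0 < x"
proof -
  have "t \<noteq> T"
    using assms by (auto simp: continuation_set_def put_value_eq val_0)
  with assms show "0 < T - t" "0 < x" by (auto simp: continuation_set_def state_space_def)
qed

text \<open>A boundary point is a limit of state-space points outside the continuation set. There V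
  is at most G, and joint continuity carries this to the limit.\<close>

lemma continuation_boundaryD:
  assumes "t < T" and bd: "(t, b) \<in> continuation_boundary M B r \<sigma> K T"
  shows "0 < b" "val (T - t) b = G b"
proof -
  let ?S = "state_space T" and ?C = "continuation_set M B r \<sigma> K T"
  have cl: "(t, b) \<in> top_of_set ?S closure_of (?S - ?C)"
    using bd by (simp add: continuation_boundary_def frontier_of_closures)
  then have S: "(t, b) \<in> ?S"
    using closure_of_subset_topspace[of "top_of_set ?S"] by auto
  then show b: "0 < b" by (simp add: state_space_def)
  have "(t, b) \<in> closure (?S - ?C)"
    using cl by (simp add: closure_of_subtopology Int_absorb1 Diff_subset)
  then obtain z where z: "\<And>n. z n \<in> ?S - ?C" "z \<longlonglongrightarrow> (t, b)"
    unfolding closure_sequential by auto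
  have t: "(\<lambda>n. fst (z n)) \<longlonglongrightarrow> t" and x: "(\<lambda>n. snd (z n)) \<longlonglongrightarrow> b"
    using tendsto_fst[OF z(2)] tendsto_snd[OF z(2)] by auto
  have "(\<lambda>n. val (T - fst (z n)) (snd (z n))) \<longlonglongrightarrow> val (T - t) b"
    using \<open>t < T\<close> b by (intro tendsto_val tendsto_intros t x) auto
  moreover have "(\<lambda>n. G (snd (z n))) \<longlonglongrightarrow> G b"
    unfolding put_gain_def by (intro tendsto_intros x)
  moreover have "val (T - fst (z n)) (snd (z n)) \<le> G (snd (z n))" for n
    using z(1)[of n] by (auto simp: continuation_set_def put_value_eq not_less split: prod.splits)
  ultimately have "val (T - t) b \<le> G b" by (intro LIMSEQ_le) auto
  then show "val (T - t) b = G b" using val_ge[of "T - t" b] \<open>t < T\<close> b by simp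
qed

lemma put_gain_has_real_derivative:
  assumes "b < K"
  shows "(G has_real_derivative -1) (at b)"
proof (rule has_field_derivative_transform_within_open)
  show "((\<lambda>x. K - x) has_real_derivative -1) (at b)"
    by (auto intro!: derivative_eq_intros)
qed (use assms in \<open>auto simp: put_gain_def intro: open_lessThan\<close>)

end

text \<open>\<open>deriv\<close> is a total function, so the differentiability claims give the limit
  its meaning. At t = T the boundary value is \<open>K\<close>, where \<open>G\<close> has no
  derivative; hence \<open>t < T\<close>.\<close>

theorem mainTheorem6:
  fixes M :: "'a measure" and B :: "real \<Rightarrow> 'a \<Rightarrow> real"
    and r \<sigma> K T t :: real and tn xn :: "nat \<Rightarrow> real"
  assumes "standard_brownian_motion M B"
    and "T > 0" and "r > 0" and "K > 0" and "\<sigma> > 0"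
    and "0 \<le> t" and "t < T"
    and "(t, stopping_boundary M B r \<sigma> K T t) \<in> continuation_boundary M B r \<sigma> K T"
    and "\<And>n. (tn n, xn n) \<in> continuation_set M B r \<sigma> K T"
    and "(\<lambda>n. (tn n, xn n)) \<longlonglongrightarrow> (t, stopping_boundary M B r \<sigma> K T t)"
  shows "(\<forall>n. put_value M B r \<sigma> K T (tn n) differentiable at (xn n)) \<and>
    (\<lambda>n. deriv (put_value M B r \<sigma> K T (tn n)) (xn n))
      \<longlonglongrightarrow> deriv (put_gain K) (stopping_boundary M B r \<sigma> K T t) \<and>
    (put_gain K has_real_derivative -1) (at (stopping_boundary M B r \<sigma> K T t))"
proof -
  interpret bm: standard_brownian_motion M B by fact
  interpret black_scholes M B r \<sigma> K by unfold_locales fact+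
  let ?b = "stopping_boundary M B r \<sigma> K T t"
  have u: "0 < T - t" using \<open>t < T\<close> by simp
  have b: "0 < ?b" "val (T - t) ?b = put_gain K ?b"
    using continuation_boundaryD[OF \<open>t < T\<close> assms(8)] by auto
  have G': "(put_gain K has_real_derivative -1) (at ?b)"
    by (intro put_gain_has_real_derivative stopping_point_less_strike[OF u b])
  have "put_value M B r \<sigma> K T (tn n) differentiable at (xn n)" for n
    unfolding put_value_eq using continuation_setD[OF assms(9)] by (intro val_differentiable)
  moreover have "(\<lambda>n. deriv (put_value M B r \<sigma> K T (tn n)) (xn n)) \<longlonglongrightarrow> -1"
    unfolding put_value_eq
    using tendsto_fst[OF assms(10)] tendsto_snd[OF assms(10)]
    by (intro deriv_val_tendsto[OF _ _ u b] tendsto_intros) auto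
  ultimately show ?thesis using G' DERIV_imp_deriv[OF G'] by simp
qed

end
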